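(* Let $A=\sigma(R)\langle x_1,\dots,x_n\rangle$ be a skew PBW extension of a ring $R$, with associated families $\Sigma=\{\sigma_1,\dots,\sigma_n\}$ of endomorphisms and $\Delta=\{\delta_1,\dots,\delta_n\}$ of $\Sigma$-derivations of $R$. If $R$ is $(\Sigma,\Delta)$-compatible and reversible, then $R$ is skew $\Pi$-Armendariz (with respect to $A$).
   Context: Rings are associative with unity, not necessarily commutative; $\mathrm{nil}(B)$ is the set of nilpotent elements of a ring $B$. A ring $B$ is reversible if $ab=0$ implies $ba=0$ for all $a,b\in B$. Skew PBW extension ($\sigma$-PBW extension): $A=\sigma(R)\langle x_1,\dots,x_n\rangle$ is a skew PBW extension of $R$ if (i) $R\subseteq A$ is a subring; (ii) there are $x_1,\dots,x_n\in A$ such that $A$ is a free left $R$-module with basis $\mathrm{Mon}(A)=\{x^\alpha=x_1^{\alpha_1}\cdots x_n^{\alpha_n}\mid \alpha\in\mathbb N^n\}$, with $x_1^0\cdots x_n^0=1$; (iii) for each $1\le i\le n$ and $r\in R\setminus\{0\}$ there is $c_{i,r}\in R\setminus\{0\}$ with $x_ir-c_{i,r}x_i\in R$; (iv) for all $1\le i,j\le n$ there is $c_{i,j}\in R\setminus\{0\}$ with $x_jx_i-c_{i,j}x_ix_j\in R+Rx_1+\cdots+Rx_n$. It is known that for each $i$ there are an injective ring endomorphism $\sigma_i:R\to R$ and a $\sigma_i$-derivation $\delta_i:R\to R$ (additive, $\delta_i(rs)=\sigma_i(r)\delta_i(s)+\delta_i(r)s$) with $x_ir=\sigma_i(r)x_i+\delta_i(r)$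 for all $r\in R$; $\Sigma=\{\sigma_1,\dots,\sigma_n\}$ and $\Delta=\{\delta_1,\dots,\delta_n\}$ are these families. For $\alpha\in\mathbb N^n$, $\sigma^\alpha=\sigma_1^{\alpha_1}\cdots\sigma_n^{\alpha_n}$ and $\delta^\alpha=\delta_1^{\alpha_1}\cdots\delta_n^{\alpha_n}$ (compositions). Compatibility: $R$ is $\Sigma$-compatible if for all $a,b\in R$ and all $\alpha\in\mathbb N^n$: $a\sigma^\alpha(b)=0\iff ab=0$. $R$ is $\Delta$-compatible if for all $a,b\in R$: $ab=0$ implies $a\delta^\beta(b)=0$ for all $\beta\in\mathbb N^n$. $R$ is $(\Sigma,\Delta)$-compatible if it is both. Elements of $A$ are written $f=\sum_{i=0}^m a_iX_i$ with $a_i\in R$, $X_0=1$, and $X_0,X_1,\dots,X_m$ distinct elements of $\mathrm{Mon}(A)$. Skew $\Pi$-Armendariz: $R$ is skew $\Pi$-Armendariz (with respect to $A$) if for all $f=\sum_{i=0}^m a_iX_i$ and $g=\sum_{j=0}^t b_jY_j$ in $A$, $fg\in\mathrm{nil}(A)$ implies $a_ib_j\in\mathrm{nil}(R)$ for all $0\le i\le m$, $0\le j\le t$. *)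

theory Defs
  imports "HOL-Algebra.Subrings"
begin

definition nilpotents :: "('a, 'm) ring_scheme \<Rightarrow> 'a set" where
  "nilpotents B = {a \<in> carrier B. \<exists>k::nat. a [^]\<^bsub>B\<^esub> k = \<zero>\<^bsub>B\<^esub>}"

definition reversible :: "('a, 'm) ring_scheme \<Rightarrow> bool" where
  "reversible B \<longleftrightarrow>
     (\<forall>a \<in> carrier B. \<forall>b \<in> carrier B. a \<otimes>\<^bsub>B\<^esub> b = \<zero>\<^bsub>B\<^esub> \<longrightarrow> b \<otimes>\<^bsub>B\<^esub> a = \<zero>\<^bsub>B\<^esub>)"

definition skew_derivation :: "('a, 'm) ring_scheme \<Rightarrow> ('a \<Rightarrow> 'a) \<Rightarrow> ('a \<Rightarrow> 'a) \<Rightarrow> bool" where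
  "skew_derivation B s d \<longleftrightarrow>
     d \<in> carrier B \<rightarrow> carrier B \<and>
     (\<forall>a \<in> carrier B. \<forall>b \<in> carrier B.
        d (a \<oplus>\<^bsub>B\<^esub> b) = d a \<oplus>\<^bsub>B\<^esub> d b \<and>
        d (a \<otimes>\<^bsub>B\<^esub> b) = (s a \<otimes>\<^bsub>B\<^esub> d b) \<oplus>\<^bsub>B\<^esub> (d a \<otimes>\<^bsub>B\<^esub> b))"

text \<open>Exponent vectors of length \<open>n\<close> are functions on \<open>{1..n}\<close>, extended by zero so that
  distinct functions are distinct vectors.\<close>

definition exponents :: "nat \<Rightarrow> (nat \<Rightarrow> nat) set" where
  "exponents n = {\<alpha>. \<forall>i. i \<notin> {1..n} \<longrightarrow> \<alpha> i = 0}"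

text \<open>The ordered product \<open>x\<^sub>1^\<alpha>\<^sub>1 \<otimes> (x\<^sub>2^\<alpha>\<^sub>2 \<otimes> \<dots>)\<close>; the order of the factors matters.\<close>

definition monomial :: "('a, 'm) ring_scheme \<Rightarrow> nat \<Rightarrow> (nat \<Rightarrow> 'a) \<Rightarrow> (nat \<Rightarrow> nat) \<Rightarrow> 'a" where
  "monomial A n x \<alpha> = foldr (\<lambda>i p. x i [^]\<^bsub>A\<^esub> \<alpha> i \<otimes>\<^bsub>A\<^esub> p) [1..<Suc n] \<one>\<^bsub>A\<^esub>"

definition monomials :: "('a, 'm) ring_scheme \<Rightarrow> nat \<Rightarrow> (nat \<Rightarrow> 'a) \<Rightarrow> 'a set" where
  "monomials A n x = monomial A n x ` exponents n"

text \<open>The composition \<open>h\<^sub>1^\<alpha>\<^sub>1 \<circ> \<dots> \<circ> h\<^sub>n^\<alpha>\<^sub>n\<close>.\<close>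

definition iterates :: "nat \<Rightarrow> (nat \<Rightarrow> 'a \<Rightarrow> 'a) \<Rightarrow> (nat \<Rightarrow> nat) \<Rightarrow> 'a \<Rightarrow> 'a" where
  "iterates n h \<alpha> = foldr (\<lambda>i g. (h i ^^ \<alpha> i) \<circ> g) [1..<Suc n] id"

text \<open>The family \<open>(v i)\<close>, \<open>i \<in> I\<close>, is a basis of \<open>A\<close> as a left module over the subring \<open>R\<close>.
  This is a condition on the indexed family, not only on its set of values: unless \<open>A\<close> is the
  zero ring, it forces \<open>v\<close> to be injective on \<open>I\<close>.\<close>

definition left_basis :: "('a, 'm) ring_scheme \<Rightarrow> 'a set \<Rightarrow> 'i set \<Rightarrow> ('i \<Rightarrow> 'a) \<Rightarrow> bool" where
  "left_basis A R I v \<longleftrightarrow>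
     v \<in> I \<rightarrow> carrier A \<and>
     (\<forall>f \<in> carrier A. \<exists>S c. finite S \<and> S \<subseteq> I \<and> c \<in> S \<rightarrow> R \<and>
        f = (\<Oplus>\<^bsub>A\<^esub>i \<in> S. c i \<otimes>\<^bsub>A\<^esub> v i)) \<and>
     (\<forall>S c. finite S \<and> S \<subseteq> I \<and> c \<in> S \<rightarrow> R \<and> (\<Oplus>\<^bsub>A\<^esub>i \<in> S. c i \<otimes>\<^bsub>A\<^esub> v i) = \<zero>\<^bsub>A\<^esub> \<longrightarrow>
        (\<forall>i \<in> S. c i = \<zero>\<^bsub>A\<^esub>))"

text \<open>\<open>linear_part A R n x\<close> is \<open>R + R x\<^sub>1 + \<dots> + R x\<^sub>n\<close>.\<close>

definition linear_part :: "('a, 'm) ring_scheme \<Rightarrow> 'a set \<Rightarrow> nat \<Rightarrow> (nat \<Rightarrow> 'a) \<Rightarrow> 'a set" where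
  "linear_part A R n x =
     {b \<oplus>\<^bsub>A\<^esub> (\<Oplus>\<^bsub>A\<^esub>k \<in> {1..n}. r k \<otimes>\<^bsub>A\<^esub> x k) | b r. b \<in> R \<and> r \<in> {1..n} \<rightarrow> R}"

locale skew_PBW_extension = ring A for A (structure) +
  fixes R :: "'a set" and n :: nat and x :: "nat \<Rightarrow> 'a"
  assumes subring: "subring R A"
    and x_closed: "x \<in> {1..n} \<rightarrow> carrier A"
    and basis: "left_basis A R (exponents n) (monomial A n x)"
    and x_coeff: "\<And>i r. \<lbrakk>i \<in> {1..n}; r \<in> R - {\<zero>}\<rbrakk> \<Longrightarrow>
      \<exists>c \<in> R - {\<zero>}. (x i \<otimes> r) \<ominus> (c \<otimes> x i) \<in> R"
    and x_x: "\<And>i j. \<lbrakk>i \<in> {1..n}; j \<in> {1..n}\<rbrakk> \<Longrightarrow>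
      \<exists>c \<in> R - {\<zero>}. (x j \<otimes> x i) \<ominus> (c \<otimes> (x i \<otimes> x j)) \<in> linear_part A R n x"

definition associated_families ::
  "('a, 'm) ring_scheme \<Rightarrow> 'a set \<Rightarrow> nat \<Rightarrow> (nat \<Rightarrow> 'a) \<Rightarrow>
     (nat \<Rightarrow> 'a \<Rightarrow> 'a) \<Rightarrow> (nat \<Rightarrow> 'a \<Rightarrow> 'a) \<Rightarrow> bool" where
  "associated_families A R n x \<sigma> \<delta> \<longleftrightarrow>
     (\<forall>i \<in> {1..n}.
        \<sigma> i \<in> ring_hom (A\<lparr>carrier := R\<rparr>) (A\<lparr>carrier := R\<rparr>) \<and> inj_on (\<sigma> i) R \<and>
        skew_derivation (A\<lparr>carrier := R\<rparr>) (\<sigma> i) (\<delta> i) \<and>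
        (\<forall>r \<in> R. x i \<otimes>\<^bsub>A\<^esub> r = (\<sigma> i r \<otimes>\<^bsub>A\<^esub> x i) \<oplus>\<^bsub>A\<^esub> \<delta> i r))"

definition Sigma_compatible :: "('a, 'm) ring_scheme \<Rightarrow> nat \<Rightarrow> (nat \<Rightarrow> 'a \<Rightarrow> 'a) \<Rightarrow> bool" where
  "Sigma_compatible B n \<sigma> \<longleftrightarrow>
     (\<forall>a \<in> carrier B. \<forall>b \<in> carrier B. \<forall>\<alpha> \<in> exponents n.
        a \<otimes>\<^bsub>B\<^esub> iterates n \<sigma> \<alpha> b = \<zero>\<^bsub>B\<^esub> \<longleftrightarrow> a \<otimes>\<^bsub>B\<^esub> b = \<zero>\<^bsub>B\<^esub>)"

definition Delta_compatible :: "('a, 'm) ring_scheme \<Rightarrow> nat \<Rightarrow> (nat \<Rightarrow> 'a \<Rightarrow> 'a) \<Rightarrow> bool" where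
  "Delta_compatible B n \<delta> \<longleftrightarrow>
     (\<forall>a \<in> carrier B. \<forall>b \<in> carrier B. a \<otimes>\<^bsub>B\<^esub> b = \<zero>\<^bsub>B\<^esub> \<longrightarrow>
        (\<forall>\<beta> \<in> exponents n. a \<otimes>\<^bsub>B\<^esub> iterates n \<delta> \<beta> b = \<zero>\<^bsub>B\<^esub>))"

definition Sigma_Delta_compatible ::
  "('a, 'm) ring_scheme \<Rightarrow> nat \<Rightarrow> (nat \<Rightarrow> 'a \<Rightarrow> 'a) \<Rightarrow> (nat \<Rightarrow> 'a \<Rightarrow> 'a) \<Rightarrow> bool" where
  "Sigma_Delta_compatible B n \<sigma> \<delta> \<longleftrightarrow> Sigma_compatible B n \<sigma> \<and> Delta_compatible B n \<delta>"

text \<open>\<open>is_expansion A R n x f m a X\<close>: the element \<open>f\<close> is written as \<open>a\<^sub>0 X\<^sub>0 + \<dots> + a\<^sub>m X\<^sub>m\<close> with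
  \<open>X\<^sub>0 = 1\<close> and distinct monomials \<open>X\<^sub>0, \<dots>, X\<^sub>m\<close>. Coefficients may vanish.\<close>

definition is_expansion ::
  "('a, 'm) ring_scheme \<Rightarrow> 'a set \<Rightarrow> nat \<Rightarrow> (nat \<Rightarrow> 'a) \<Rightarrow>
     'a \<Rightarrow> nat \<Rightarrow> (nat \<Rightarrow> 'a) \<Rightarrow> (nat \<Rightarrow> 'a) \<Rightarrow> bool" where
  "is_expansion A R n x f m a X \<longleftrightarrow>
     a \<in> {0..m} \<rightarrow> R \<and> X \<in> {0..m} \<rightarrow> monomials A n x \<and> inj_on X {0..m} \<and> X 0 = \<one>\<^bsub>A\<^esub> \<and>
     f = (\<Oplus>\<^bsub>A\<^esub>i \<in> {0..m}. a i \<otimes>\<^bsub>A\<^esub> X i)"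

definition skew_Pi_Armendariz ::
  "('a, 'm) ring_scheme \<Rightarrow> 'a set \<Rightarrow> nat \<Rightarrow> (nat \<Rightarrow> 'a) \<Rightarrow> bool" where
  "skew_Pi_Armendariz A R n x \<longleftrightarrow>
     (\<forall>f g m t a b X Y.
        is_expansion A R n x f m a X \<and> is_expansion A R n x g t b Y \<and>
        f \<otimes>\<^bsub>A\<^esub> g \<in> nilpotents A \<longrightarrow>
        (\<forall>i \<in> {0..m}. \<forall>j \<in> {0..t}. a i \<otimes>\<^bsub>A\<^esub> b j \<in> nilpotents (A\<lparr>carrier := R\<rparr>)))"

text \<open>The families \<open>\<sigma>\<close> and \<open>\<delta>\<close> associated with a skew PBW extension exist and are determined
  on \<open>R\<close> by the commutation rule, so \<open>associated_families\<close> is not a restriction.\<close>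

context skew_PBW_extension
begin

lemma x_in: "Suc 0 \<le> i \<Longrightarrow> i \<le> n \<Longrightarrow> x i \<in> carrier A"
  using x_closed by auto

lemma foldr_one_if:
  assumes "distinct is" "set is \<subseteq> {1..n}"
  shows "foldr (\<lambda>i p. x i [^] (if i = j then 1 else 0 :: nat) \<otimes> p) is \<one>
    = (if j \<in> set is then x j else \<one>)"
  using assms by (induction "is") (auto simp: x_in)

lemma monomial_unit: "i \<in> {1..n} \<Longrightarrow> monomial A n x (\<lambda>j. if j = i then 1 else 0) = x i"
  using foldr_one_if[of "[1..<Suc n]" i] by (force simp: monomial_def)

lemma monomial_zero: "monomial A n x (\<lambda>_. 0) = \<one>"
proof -
  have "foldr (\<lambda>i p. x i [^] (0 :: nat) \<otimes> p) is \<one> = \<one>" for "is"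
    by (induction "is") auto
  thus ?thesis by (simp only: monomial_def)
qed

lemma basis_indep:
  assumes "finite S" "S \<subseteq> exponents n" "c \<in> S \<rightarrow> R"
    and "(\<Oplus>\<alpha> \<in> S. c \<alpha> \<otimes> monomial A n x \<alpha>) = \<zero>"
  shows "\<forall>\<alpha> \<in> S. c \<alpha> = \<zero>"
  using assms basis unfolding left_basis_def by blast

lemma linear_indep:
  assumes "i \<in> {1..n}" "c \<in> R" "d \<in> R" "(c \<otimes> x i) \<oplus> d = \<zero>"
  shows "c = \<zero> \<and> d = \<zero>"
proof -
  let ?e = "\<lambda>j. if j = i then 1 else 0 :: nat" and ?z = "\<lambda>_. 0 :: nat"
  have ne: "?e \<noteq> ?z" by (metis one_neq_zero)
  note RA = subringE(1)[OF subring]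
  let ?c = "\<lambda>\<alpha>. if \<alpha> = ?e then c else d"
  have xi: "x i \<in> carrier A" using assms(1) x_closed by auto
  have "(\<Oplus>\<alpha> \<in> {?e, ?z}. ?c \<alpha> \<otimes> monomial A n x \<alpha>)
     = (?c ?e \<otimes> monomial A n x ?e) \<oplus> (\<Oplus>\<alpha> \<in> {?z}. ?c \<alpha> \<otimes> monomial A n x \<alpha>)"
    using ne assms RA xi monomial_unit[OF assms(1)] monomial_zero
    by (intro finsum_insert) (auto simp: Pi_def)
  also have "(\<Oplus>\<alpha> \<in> {?z}. ?c \<alpha> \<otimes> monomial A n x \<alpha>) = ?c ?z \<otimes> monomial A n x ?z"
    using ne assms RA monomial_zero by (subst finsum_insert) (auto simp: Pi_def)
  also have "(?c ?e \<otimes> monomial A n x ?e) \<oplus> (?c ?z \<otimes> monomial A n x ?z) = \<zero>"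
    using ne assms RA monomial_unit[OF assms(1)] monomial_zero by auto
  finally have sum: "(\<Oplus>\<alpha> \<in> {?e, ?z}. ?c \<alpha> \<otimes> monomial A n x \<alpha>) = \<zero>" .
  have fin: "finite {?e, ?z}" by (rule finite.insertI, rule finite.insertI, rule finite.emptyI)
  have sub: "{?e, ?z} \<subseteq> exponents n" and cR: "?c \<in> {?e, ?z} \<rightarrow> R"
    using assms by (auto simp: exponents_def)
  note all = basis_indep[OF fin sub cR sum]
  have "?c ?e = \<zero>" by (rule bspec[OF all]) (rule insertI1)
  moreover have "?c ?z = \<zero>" by (rule bspec[OF all]) (rule insertI2, rule insertI1)
  ultimately show ?thesis using ne by (simp only: if_True if_False refl not_sym simp_thms)
qed

lemma linear_unique:
  assumes "i \<in> {1..n}" "c \<in> R" "d \<in> R" "c' \<in> R" "d' \<in> R"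
    "(c \<otimes> x i) \<oplus> d = (c' \<otimes> x i) \<oplus> d'"
  shows "c = c' \<and> d = d'"
proof -
  note RA = subsetD[OF subringE(1)[OF subring]]
  have xi: "x i \<in> carrier A" using assms(1) x_closed by auto
  note car = RA[OF assms(2)] RA[OF assms(3)] RA[OF assms(4)] RA[OF assms(5)] xi
  have "((c \<ominus> c') \<otimes> x i) \<oplus> (d \<ominus> d') = ((c \<otimes> x i) \<oplus> d) \<ominus> ((c' \<otimes> x i) \<oplus> d')"
    using car by algebra
  also have "\<dots> = \<zero>" using assms(6) car by (simp add: r_neg a_minus_def)
  finally have "((c \<ominus> c') \<otimes> x i) \<oplus> (d \<ominus> d') = \<zero>" .
  moreover have "c \<ominus> c' \<in> R" "d \<ominus> d' \<in> R"
    using assms subringE(5,7)[OF subring] by (auto simp: a_minus_def)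
  ultimately have "c \<ominus> c' = \<zero>" "d \<ominus> d' = \<zero>" using linear_indep assms(1) by blast+
  thus ?thesis using car by (simp add: r_right_minus_eq)
qed

theorem associated_families_unique:
  assumes "associated_families A R n x \<sigma> \<delta>" "associated_families A R n x \<sigma>' \<delta>'"
    and "i \<in> {1..n}" "r \<in> R"
  shows "\<sigma> i r = \<sigma>' i r" "\<delta> i r = \<delta>' i r"
proof -
  have "\<sigma> i r \<in> R" "\<sigma>' i r \<in> R" "\<delta> i r \<in> R" "\<delta>' i r \<in> R"
    using assms unfolding associated_families_def ring_hom_def skew_derivation_def by auto
  moreover have "(\<sigma> i r \<otimes> x i) \<oplus> \<delta> i r = (\<sigma>' i r \<otimes> x i) \<oplus> \<delta>' i r"
    using assms unfolding associated_families_def by metis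
  ultimately show "\<sigma> i r = \<sigma>' i r" "\<delta> i r = \<delta>' i r"
    using linear_unique[OF assms(3)] by blast+
qed

theorem associated_families_exist: "\<exists>\<sigma> \<delta>. associated_families A R n x \<sigma> \<delta>"
proof -
  note RA = subsetD[OF subringE(1)[OF subring]]
  have zR: "\<zero> \<in> R" and oR: "\<one> \<in> R" using subringE[OF subring] by auto
  have mR: "\<And>a b. a \<in> R \<Longrightarrow> b \<in> R \<Longrightarrow> a \<otimes> b \<in> R" and aR: "\<And>a b. a \<in> R \<Longrightarrow> b \<in> R \<Longrightarrow> a \<oplus> b \<in> R"
    and nR: "\<And>a. a \<in> R \<Longrightarrow> \<ominus> a \<in> R"
    using subringE[OF subring] by auto
  have ex: "\<exists>c d. c \<in> R \<and> d \<in> R \<and> x i \<otimes> r = (c \<otimes> x i) \<oplus> d \<and> (r \<noteq> \<zero> \<longrightarrow> c \<noteq> \<zero>)"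
    if i: "i \<in> {1..n}" and r: "r \<in> R" for i r
  proof (cases "r = \<zero>")
    case True
    thus ?thesis using i zR by (intro exI[of _ \<zero>]) (auto simp: x_in)
  next
    case False
    then obtain c where c: "c \<in> R" "c \<noteq> \<zero>" "(x i \<otimes> r) \<ominus> (c \<otimes> x i) \<in> R"
      using x_coeff[OF i, of r] r by blast
    have xi: "x i \<in> carrier A" using i x_closed by auto
    have "x i \<otimes> r = (c \<otimes> x i) \<oplus> ((x i \<otimes> r) \<ominus> (c \<otimes> x i))"
      using xi RA[OF r] RA[OF c(1)] by algebra
    thus ?thesis using c by blast
  qed
  then obtain \<sigma> \<delta> where sd: "\<And>i r. i \<in> {1..n} \<Longrightarrow> r \<in> R \<Longrightarrow> \<sigma> i r \<in> R \<and> \<delta> i r \<in> R \<and>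
      x i \<otimes> r = (\<sigma> i r \<otimes> x i) \<oplus> \<delta> i r \<and> (r \<noteq> \<zero> \<longrightarrow> \<sigma> i r \<noteq> \<zero>)"
    by metis
  have "associated_families A R n x \<sigma> \<delta>"
    unfolding associated_families_def
  proof (intro ballI)
    fix i assume i: "i \<in> {1..n}"
    have xi: "x i \<in> carrier A" using i x_closed by auto
    note s = sd[OF i]
    have add: "\<sigma> i (a \<oplus> b) = \<sigma> i a \<oplus> \<sigma> i b \<and> \<delta> i (a \<oplus> b) = \<delta> i a \<oplus> \<delta> i b"
      if a: "a \<in> R" and b: "b \<in> R" for a b
    proof (rule linear_unique[OF i])
      have car: "a \<in> carrier A" "b \<in> carrier A" "\<sigma> i a \<in> carrier A" "\<sigma> i b \<in> carrier A"
        "\<delta> i a \<in> carrier A" "\<delta> i b \<in> carrier A" using s a b RA by auto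
      have "x i \<otimes> (a \<oplus> b) = (x i \<otimes> a) \<oplus> (x i \<otimes> b)" using car xi by algebra
      also have "\<dots> = ((\<sigma> i a \<otimes> x i) \<oplus> \<delta> i a) \<oplus> ((\<sigma> i b \<otimes> x i) \<oplus> \<delta> i b)"
        using s a b by metis
      also have "\<dots> = ((\<sigma> i a \<oplus> \<sigma> i b) \<otimes> x i) \<oplus> (\<delta> i a \<oplus> \<delta> i b)" using car xi by algebra
      finally show "(\<sigma> i (a \<oplus> b) \<otimes> x i) \<oplus> \<delta> i (a \<oplus> b) =
          ((\<sigma> i a \<oplus> \<sigma> i b) \<otimes> x i) \<oplus> (\<delta> i a \<oplus> \<delta> i b)"
        using s[OF aR[OF a b]] by metis
    qed (use s a b aR in auto)
    have mul: "\<sigma> i (a \<otimes> b) = \<sigma> i a \<otimes> \<sigma> i b \<and> \<delta> i (a \<otimes> b) = (\<sigma> i a \<otimes> \<delta> i b) \<oplus> (\<delta> i a \<otimes> b)"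
      if a: "a \<in> R" and b: "b \<in> R" for a b
    proof (rule linear_unique[OF i])
      have car: "a \<in> carrier A" "b \<in> carrier A" "\<sigma> i a \<in> carrier A" "\<sigma> i b \<in> carrier A"
        "\<delta> i a \<in> carrier A" "\<delta> i b \<in> carrier A" using s a b RA by auto
      have "x i \<otimes> (a \<otimes> b) = (x i \<otimes> a) \<otimes> b" using car xi by (simp add: m_assoc)
      also have "\<dots> = ((\<sigma> i a \<otimes> x i) \<oplus> \<delta> i a) \<otimes> b" using s a by metis
      also have "\<dots> = (\<sigma> i a \<otimes> (x i \<otimes> b)) \<oplus> (\<delta> i a \<otimes> b)"
        using car xi by (simp add: l_distr m_assoc)
      also have "\<dots> = (\<sigma> i a \<otimes> ((\<sigma> i b \<otimes> x i) \<oplus> \<delta> i b)) \<oplus> (\<delta> i a \<otimes> b)" using s b by metis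
      also have "\<dots> = ((\<sigma> i a \<otimes> \<sigma> i b) \<otimes> x i) \<oplus> ((\<sigma> i a \<otimes> \<delta> i b) \<oplus> (\<delta> i a \<otimes> b))"
        using car xi by (simp add: r_distr m_assoc a_assoc)
      finally show "(\<sigma> i (a \<otimes> b) \<otimes> x i) \<oplus> \<delta> i (a \<otimes> b) =
          ((\<sigma> i a \<otimes> \<sigma> i b) \<otimes> x i) \<oplus> ((\<sigma> i a \<otimes> \<delta> i b) \<oplus> (\<delta> i a \<otimes> b))"
        using s[OF mR[OF a b]] by metis
    qed (use s a b aR mR in auto)
    have one: "\<sigma> i \<one> = \<one> \<and> \<delta> i \<one> = \<zero>"
    proof (rule linear_unique[OF i])
      show "(\<sigma> i \<one> \<otimes> x i) \<oplus> \<delta> i \<one> = (\<one> \<otimes> x i) \<oplus> \<zero>"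
        using s[OF oR] xi by (metis l_one r_one r_zero)
    qed (use s oR zR in auto)
    have inj: "inj_on (\<sigma> i) R"
    proof (rule inj_onI)
      fix a b assume ab: "a \<in> R" "b \<in> R" "\<sigma> i a = \<sigma> i b"
      have nb: "\<ominus> b \<in> R" using nR ab by blast
      have "\<sigma> i b \<oplus> \<sigma> i (\<ominus> b) = \<sigma> i (b \<oplus> \<ominus> b)" using add[OF ab(2) nb] by simp
      hence "\<sigma> i (a \<oplus> \<ominus> b) = \<sigma> i \<zero>"
        using add[OF ab(1) nb] ab RA by (simp add: r_neg)
      moreover have "\<sigma> i \<zero> = \<zero>"
        using add[OF zR zR] s[OF zR] RA by (metis add.r_cancel_one l_zero zero_closed)
      ultimately have "a \<oplus> \<ominus> b = \<zero>" using s[OF aR[OF ab(1) nb]] by metis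
      thus "a = b" using ab RA by (metis minus_equality minus_minus add.inv_closed)
    qed
    show "\<sigma> i \<in> ring_hom (A\<lparr>carrier := R\<rparr>) (A\<lparr>carrier := R\<rparr>) \<and> inj_on (\<sigma> i) R \<and>
        skew_derivation (A\<lparr>carrier := R\<rparr>) (\<sigma> i) (\<delta> i) \<and>
        (\<forall>r \<in> R. x i \<otimes> r = (\<sigma> i r \<otimes> x i) \<oplus> \<delta> i r)"
      using inj s add mul one by (auto simp: ring_hom_def skew_derivation_def)
  qed
  thus ?thesis by blast
qed

end

end

theory Submission
  imports Defs
begin

text \<open>In a reversible ring \<open>R\<close> the nilpotents form an ideal \<open>N\<close> with \<open>R / N\<close> reduced. If
  \<open>a b \<notin> N\<close>, choose a maximal multiplicative set \<open>S\<close> that contains \<open>a b\<close> and misses \<open>N\<close>. Its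
  complement \<open>P\<close> is a completely prime ideal, and \<open>r \<in> P\<close> holds exactly if \<open>s r \<in> N\<close> for some
  \<open>s \<in> S\<close> (so \<open>P\<close> is a minimal prime). By this description, compatibility makes \<open>P\<close> stable under
  all \<open>\<sigma>\<^sub>i\<close>, \<open>\<sigma>\<^sub>i\<^sup>-\<^sup>1\<close> and \<open>\<delta>\<^sub>i\<close>, so modulo \<open>P\<close> leading terms multiply as in a skew PBW extension of
  a domain: if \<open>f\<close> and \<open>g\<close> each have a coefficient outside \<open>P\<close>, then so has every power of \<open>f g\<close>,
  and \<open>f g\<close> is not nilpotent. Leading terms are taken with respect to a weight that is injective
  on the exponents of \<open>f\<close> and \<open>g\<close>, which takes the place of a monomial order.\<close>

section \<open>Reversible rings\<close>

locale reversible_ring = ring R for R (structure) +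
  assumes reversible: "reversible R"
begin

lemma mult_zero_commute:
  "\<lbrakk>a \<in> carrier R; b \<in> carrier R; a \<otimes> b = \<zero>\<rbrakk> \<Longrightarrow> b \<otimes> a = \<zero>"
  using reversible unfolding reversible_def by blast

text \<open>Reversibility moves \<open>b\<close> to the front, where \<open>r\<close> can be
  multiplied on at the right end; a second reversal moves \<open>b\<close> back. This insertion
  property drives all later arguments on nilpotents.\<close>

lemma mult_zero_insert:
  assumes "a \<in> carrier R" "r \<in> carrier R" "b \<in> carrier R" "a \<otimes> b = \<zero>"
  shows "a \<otimes> r \<otimes> b = \<zero>"
proof -
  have "b \<otimes> (a \<otimes> r) = b \<otimes> a \<otimes> r" using assms by (simp add: m_assoc)
  also have "\<dots> = \<zero>" using assms mult_zero_commute[of a b] by simp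
  finally show ?thesis using assms mult_zero_commute[of b "a \<otimes> r"] by simp
qed

section \<open>The ideal of nilpotent elements of a reversible ring\<close>

lemma nilpotents_closed: "a \<in> nilpotents R \<Longrightarrow> a \<in> carrier R"
  by (simp add: nilpotents_def)

lemma nilpotentsI: "\<lbrakk>a \<in> carrier R; a [^] (k::nat) = \<zero>\<rbrakk> \<Longrightarrow> a \<in> nilpotents R"
  by (auto simp: nilpotents_def)

lemma zero_nilpotent: "\<zero> \<in> nilpotents R"
  unfolding nilpotents_def by (auto intro: exI[of _ "1::nat"])

text \<open>The prefix \<open>z\<close> makes the induction work: once \<open>r\<close> is inserted
  into the first factor, that factor is absorbed into \<open>z\<close> and the remaining power is
  one shorter.\<close>

lemma pow_zero_insert:
  assumes "z \<in> carrier R" "a \<in> carrier R" "r \<in> carrier R" "b \<in> carrier R"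
    and "z \<otimes> (a \<otimes> b) [^] (k::nat) = \<zero>"
  shows "z \<otimes> (a \<otimes> r \<otimes> b) [^] k = \<zero>"
  using assms(1,5)
proof (induction k arbitrary: z)
  case (Suc k)
  note car = Suc.prems(1) assms(2-4)
  have "(a \<otimes> b) [^] Suc k = (a \<otimes> b) \<otimes> (a \<otimes> b) [^] k"
    using car by (intro nat_pow_Suc2) auto
  then have "(z \<otimes> a) \<otimes> (b \<otimes> (a \<otimes> b) [^] k) = \<zero>"
    using Suc.prems(2) car by (simp add: m_assoc del: nat_pow_Suc)
  then have "(z \<otimes> a) \<otimes> r \<otimes> (b \<otimes> (a \<otimes> b) [^] k) = \<zero>"
    using car by (intro mult_zero_insert[of "z \<otimes> a" r "b \<otimes> (a \<otimes> b) [^] k"]) simp_all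
  then have "(z \<otimes> (a \<otimes> r \<otimes> b)) \<otimes> (a \<otimes> b) [^] k = \<zero>"
    using car by (simp add: m_assoc)
  then have "(z \<otimes> (a \<otimes> r \<otimes> b)) \<otimes> (a \<otimes> r \<otimes> b) [^] k = \<zero>"
    using car by (intro Suc.IH) auto
  moreover have "(a \<otimes> r \<otimes> b) [^] Suc k = (a \<otimes> r \<otimes> b) \<otimes> (a \<otimes> r \<otimes> b) [^] k"
    using car by (intro nat_pow_Suc2) auto
  ultimately show ?case
    using car by (simp add: m_assoc del: nat_pow_Suc)
qed auto

lemma nilpotent_insert:
  assumes "a \<in> carrier R" "r \<in> carrier R" "b \<in> carrier R" "a \<otimes> b \<in> nilpotents R"
  shows "a \<otimes> r \<otimes> b \<in> nilpotents R"
proof -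
  obtain k :: nat where "(a \<otimes> b) [^] k = \<zero>"
    using assms(4) by (auto simp: nilpotents_def)
  then have "\<one> \<otimes> (a \<otimes> r \<otimes> b) [^] k = \<zero>"
    using assms by (intro pow_zero_insert) auto
  then have "(a \<otimes> r \<otimes> b) [^] k = \<zero>" using assms(1-3) by simp
  then show ?thesis using assms(1-3) by (blast intro: nilpotentsI)
qed

lemma nilpotent_commute:
  assumes "a \<in> carrier R" "b \<in> carrier R" "a \<otimes> b \<in> nilpotents R"
  shows "b \<otimes> a \<in> nilpotents R"
proof -
  obtain k :: nat where k: "(a \<otimes> b) [^] k = \<zero>"
    using assms(3) by (auto simp: nilpotents_def)
  have shift: "(b \<otimes> a) [^] (Suc j) = b \<otimes> (a \<otimes> b) [^] j \<otimes> a" for j :: nat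
    using assms(1,2) by (induction j) (auto simp: m_assoc)
  have "(b \<otimes> a) [^] (Suc k) = \<zero>"
    unfolding shift using assms k by simp
  then show ?thesis using assms(1,2) unfolding nilpotents_def by blast
qed

lemma nilpotent_lmult: "\<lbrakk>r \<in> carrier R; a \<in> nilpotents R\<rbrakk> \<Longrightarrow> r \<otimes> a \<in> nilpotents R"
  using nilpotent_insert[of \<one> r a] nilpotents_closed by simp

lemma nilpotent_rmult: "\<lbrakk>r \<in> carrier R; a \<in> nilpotents R\<rbrakk> \<Longrightarrow> a \<otimes> r \<in> nilpotents R"
  using nilpotent_lmult nilpotent_commute nilpotents_closed by simp

text \<open>Without commutativity there is no binomial formula, so one factor is expanded at a time.
  The summand with prefix \<open>y \<otimes> a\<close> needs one power of \<open>a\<close> less,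
  while insertion preserves the annihilation of the power of \<open>b\<close>; the other summand is
  symmetric. If an exponent is 0, then \<open>y\<close> itself is zero.\<close>

lemma pow_add_annihilate:
  assumes "y \<in> carrier R" "a \<in> carrier R" "b \<in> carrier R"
    and "y \<otimes> a [^] (k::nat) = \<zero>" "y \<otimes> b [^] (l::nat) = \<zero>"
  shows "y \<otimes> (a \<oplus> b) [^] (k + l) = \<zero>"
  using assms(1,4,5)
proof (induction "k + l" arbitrary: y k l)
  case 0
  then show ?case by simp
next
  case (Suc m)
  note car = Suc.prems(1) assms(2,3)
  show ?case
  proof (cases "k = 0 \<or> l = 0")
    case True
    then have "y = \<zero>" using Suc.prems by auto
    then show ?thesis using car by simp
  next
    case False
    then obtain k' l' where kl: "k = Suc k'" "l = Suc l'" by (metis not0_implies_Suc)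
    have ya: "y \<otimes> a \<otimes> a [^] k' = \<zero>" and yb: "y \<otimes> b \<otimes> b [^] l' = \<zero>"
      using Suc.prems car nat_pow_Suc2[of a k'] nat_pow_Suc2[of b l'] unfolding kl
      by (simp_all add: m_assoc del: nat_pow_Suc)
    have ya': "y \<otimes> a \<otimes> b [^] l = \<zero>" and yb': "y \<otimes> b \<otimes> a [^] k = \<zero>"
      using Suc.prems car by (auto intro!: mult_zero_insert)
    have "y \<otimes> a \<otimes> (a \<oplus> b) [^] (k' + l) = \<zero>"
      using Suc.hyps(1)[of k' l "y \<otimes> a"] Suc.hyps(2) ya ya' car kl by simp
    moreover have "y \<otimes> b \<otimes> (a \<oplus> b) [^] (k + l') = \<zero>"
      using Suc.hyps(1)[of k l' "y \<otimes> b"] Suc.hyps(2) yb yb' car kl by simp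
    moreover have "k' + l = m" "k + l' = m" "k + l = Suc m" using kl Suc.hyps(2) by auto
    moreover have "(a \<oplus> b) [^] Suc m = (a \<oplus> b) \<otimes> (a \<oplus> b) [^] m"
      using car by (intro nat_pow_Suc2) auto
    moreover have "y \<otimes> ((a \<oplus> b) \<otimes> (a \<oplus> b) [^] m)
        = y \<otimes> a \<otimes> (a \<oplus> b) [^] m \<oplus> y \<otimes> b \<otimes> (a \<oplus> b) [^] m"
      using car by (simp add: l_distr r_distr m_assoc)
    ultimately show ?thesis using car by (simp del: nat_pow_Suc)
  qed
qed

lemma nilpotent_add:
  assumes "a \<in> nilpotents R" "b \<in> nilpotents R"
  shows "a \<oplus> b \<in> nilpotents R"
proof -
  obtain k l :: nat where "a [^] k = \<zero>" "b [^] l = \<zero>"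
    using assms by (auto simp: nilpotents_def)
  then have "\<one> \<otimes> (a \<oplus> b) [^] (k + l) = \<zero>"
    using assms nilpotents_closed by (intro pow_add_annihilate) auto
  then have "(a \<oplus> b) [^] (k + l) = \<zero>" using assms nilpotents_closed by simp
  then show ?thesis using assms nilpotents_closed by (blast intro: nilpotentsI)
qed

lemma nilpotent_square:
  assumes "a \<in> carrier R" "a \<otimes> a \<in> nilpotents R"
  shows "a \<in> nilpotents R"
proof -
  obtain k :: nat where "(a \<otimes> a) [^] k = \<zero>"
    using assms(2) by (auto simp: nilpotents_def)
  moreover have "a \<otimes> a = a [^] (2::nat)" using assms(1) by (simp add: numeral_2_eq_2)
  ultimately have "a [^] (2 * k) = \<zero>" using assms(1) by (simp add: nat_pow_pow)
  then show ?thesis using assms(1) unfolding nilpotents_def by blast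
qed

text \<open>The assumption on annihilators is what compatibility supplies, with \<open>h\<close> an
  image of \<open>b\<close> under some \<open>\<sigma> i\<close> or \<open>\<delta> i\<close>, or
  \<open>b\<close> an image of \<open>h\<close> under \<open>\<sigma> i\<close>. The last factor is
  replaced first; reversibility then rotates it into the prefix, the induction hypothesis treats the
  rest, and a second rotation restores the order.\<close>

lemma pow_zero_replace:
  assumes "z \<in> carrier R" "a \<in> carrier R" "b \<in> carrier R" "h \<in> carrier R"
    and ann: "\<And>y. \<lbrakk>y \<in> carrier R; y \<otimes> b = \<zero>\<rbrakk> \<Longrightarrow> y \<otimes> h = \<zero>"
    and "z \<otimes> (a \<otimes> b) [^] (k::nat) = \<zero>"
  shows "z \<otimes> (a \<otimes> h) [^] k = \<zero>"
  using assms(1,6)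
proof (induction k arbitrary: z)
  case (Suc k)
  note car = Suc.prems(1) assms(2-4)
  have "(z \<otimes> (a \<otimes> b) [^] k \<otimes> a) \<otimes> b = \<zero>"
    using Suc.prems(2) car by (simp add: m_assoc)
  then have "(z \<otimes> (a \<otimes> b) [^] k \<otimes> a) \<otimes> h = \<zero>"
    using car by (intro ann) auto
  then have "(z \<otimes> (a \<otimes> b) [^] k) \<otimes> (a \<otimes> h) = \<zero>"
    using car by (simp add: m_assoc)
  then have "(a \<otimes> h) \<otimes> (z \<otimes> (a \<otimes> b) [^] k) = \<zero>"
    using car by (intro mult_zero_commute[of "z \<otimes> (a \<otimes> b) [^] k"]) auto
  then have "(a \<otimes> h \<otimes> z) \<otimes> (a \<otimes> b) [^] k = \<zero>"
    using car by (simp add: m_assoc)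
  then have "(a \<otimes> h \<otimes> z) \<otimes> (a \<otimes> h) [^] k = \<zero>"
    using car by (intro Suc.IH) auto
  then have "(a \<otimes> h) \<otimes> (z \<otimes> (a \<otimes> h) [^] k) = \<zero>"
    using car by (simp add: m_assoc)
  then have "(z \<otimes> (a \<otimes> h) [^] k) \<otimes> (a \<otimes> h) = \<zero>"
    using car by (intro mult_zero_commute[of "a \<otimes> h"]) auto
  then show ?case using car by (simp add: m_assoc)
qed auto

lemma nilpotent_replace:
  assumes "a \<in> carrier R" "b \<in> carrier R" "h \<in> carrier R"
    and "\<And>y. \<lbrakk>y \<in> carrier R; y \<otimes> b = \<zero>\<rbrakk> \<Longrightarrow> y \<otimes> h = \<zero>"
    and "a \<otimes> b \<in> nilpotents R"
  shows "a \<otimes> h \<in> nilpotents R"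
proof -
  obtain k :: nat where "(a \<otimes> b) [^] k = \<zero>"
    using assms(5) by (auto simp: nilpotents_def)
  then have "\<one> \<otimes> (a \<otimes> b) [^] k = \<zero>" using assms(1,2) by simp
  from pow_zero_replace[OF one_closed assms(1-4) this]
  have "\<one> \<otimes> (a \<otimes> h) [^] k = \<zero>" by simp
  then have "(a \<otimes> h) [^] k = \<zero>" using assms(1,3) by simp
  then show ?thesis using assms(1,3) by (blast intro: nilpotentsI)
qed

section \<open>Maximal multiplicative sets without nilpotents, and their complements\<close>

definition avoiding :: "'a set \<Rightarrow> bool" where
  "avoiding S \<longleftrightarrow> S \<subseteq> carrier R \<and> \<one> \<in> S \<and> (\<forall>u \<in> S. \<forall>v \<in> S. u \<otimes> v \<in> S) \<and>
     S \<inter> nilpotents R = {}"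

lemma avoiding_powers:
  assumes "c \<in> carrier R" "c \<notin> nilpotents R"
  shows "avoiding {c [^] k | k::nat. True}"
proof -
  have "c [^] k \<notin> nilpotents R" for k :: nat
  proof
    assume "c [^] k \<in> nilpotents R"
    then obtain m :: nat where "c [^] (k * m) = \<zero>"
      using assms(1) by (auto simp: nilpotents_def nat_pow_pow)
    then show False using assms by (auto simp: nilpotents_def)
  qed
  moreover have "\<one> = c [^] (0::nat)" by simp
  ultimately show ?thesis
    unfolding avoiding_def using assms(1) by (auto simp: nat_pow_mult) (metis nat_pow_0)
qed

text \<open>By Zorn's lemma, starting from the powers of \<open>c\<close>. Two elements of the union
  of a chain lie in a common member, so the union is again multiplicative.\<close>

lemma maximal_avoiding:
  assumes "c \<in> carrier R" "c \<notin> nilpotents R"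
  obtains S where "avoiding S" "c \<in> S" "\<And>T. \<lbrakk>avoiding T; S \<subseteq> T\<rbrakk> \<Longrightarrow> T = S"
proof -
  let ?F = "{S. avoiding S \<and> c \<in> S}"
  have "\<exists>S \<in> ?F. \<forall>T \<in> ?F. S \<subseteq> T \<longrightarrow> T = S"
  proof (rule subset_Zorn_nonempty)
    have "c = c [^] (1::nat)" using assms by simp
    then show "?F \<noteq> {}" using avoiding_powers[OF assms] by blast
  next
    fix C assume C: "C \<noteq> {}" "subset.chain ?F C"
    have "u \<otimes> v \<in> \<Union>C" if uv: "u \<in> \<Union>C" "v \<in> \<Union>C" for u v
    proof -
      obtain S T where ST: "u \<in> S" "v \<in> T" "S \<in> C" "T \<in> C" using uv by blast
      then have "S \<subseteq> T \<or> T \<subseteq> S" using C(2) by (auto simp: subset_chain_def)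
      then obtain U where "U \<in> C" "u \<in> U" "v \<in> U" using ST by blast
      then show ?thesis using C(2) unfolding subset_chain_def avoiding_def by blast
    qed
    moreover have each: "avoiding S" "c \<in> S" if "S \<in> C" for S
      using C(2) that unfolding subset_chain_def by blast+
    have "\<Union>C \<subseteq> carrier R" "\<Union>C \<inter> nilpotents R = {}"
      using each(1) unfolding avoiding_def by blast+
    moreover have "\<one> \<in> \<Union>C" "c \<in> \<Union>C"
      using C(1) each unfolding avoiding_def by blast+
    ultimately show "\<Union>C \<in> ?F" unfolding avoiding_def by blast
  qed
  then show ?thesis using that by blast
qed

lemma maximal_avoiding_complement:
  assumes S: "avoiding S" "\<And>T. \<lbrakk>avoiding T; S \<subseteq> T\<rbrakk> \<Longrightarrow> T = S"
    and a: "a \<in> carrier R"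
  shows "a \<notin> S \<longleftrightarrow> (\<exists>s \<in> S. s \<otimes> a \<in> nilpotents R)"
proof
  assume "\<exists>s \<in> S. s \<otimes> a \<in> nilpotents R"
  then show "a \<notin> S" using S(1) unfolding avoiding_def by blast
next
  assume aS: "a \<notin> S"
  have Sc: "\<And>s. s \<in> S \<Longrightarrow> s \<in> carrier R" using S(1) by (auto simp: avoiding_def)
  \<comment> \<open>\<open>T\<close> stands in for the multiplicative closure of \<open>S\<close>
    and \<open>a\<close>. Instead of words in these elements it collects every \<open>u\<close>
    whose right annihilator modulo the nilpotents is contained in that of some
    \<open>s \<otimes> a\<close>. Modulo the nilpotents the ring is reduced, so neither the order
    nor the repetition of factors affects such annihilators.\<close>
  define T where "T = {u \<in> carrier R. \<exists>s \<in> S. \<forall>r \<in> carrier R.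
    u \<otimes> r \<in> nilpotents R \<longrightarrow> s \<otimes> a \<otimes> r \<in> nilpotents R}"
  show "\<exists>s \<in> S. s \<otimes> a \<in> nilpotents R"
  proof (rule ccontr)
    assume no: "\<not> ?thesis"
    \<comment> \<open>An element of \<open>S\<close> is its own \<open>s\<close>, by insertion of
      \<open>a\<close>; for \<open>a\<close> itself, \<open>s\<close> is the unit.\<close>
    have "S \<subseteq> T"
      unfolding T_def using a Sc nilpotent_insert by blast
    have "a \<in> T"
      unfolding T_def using a S(1) by (auto simp: avoiding_def intro!: bexI[of _ \<one>])
    have "u \<otimes> v \<in> T" if uv: "u \<in> T" "v \<in> T" for u v
    proof -
      obtain s t where st: "s \<in> S" "t \<in> S"
        and s: "\<And>r. r \<in> carrier R \<Longrightarrow> u \<otimes> r \<in> nilpotents R \<Longrightarrow> s \<otimes> a \<otimes> r \<in> nilpotents R"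
        and t: "\<And>r. r \<in> carrier R \<Longrightarrow> v \<otimes> r \<in> nilpotents R \<Longrightarrow> t \<otimes> a \<otimes> r \<in> nilpotents R"
        using uv unfolding T_def by blast
      have c: "u \<in> carrier R" "v \<in> carrier R" "s \<in> carrier R" "t \<in> carrier R"
        using uv st Sc by (auto simp: T_def)
      \<comment> \<open>The defining conditions of \<open>u\<close> and \<open>v\<close> are applied
        in turn, with rotations in between that bring \<open>v\<close> to the front. Insertions then
        complete the result to the square of
        \<open>s \<otimes> t \<otimes> a \<otimes> r\<close>.\<close>
      have "s \<otimes> t \<otimes> a \<otimes> r \<in> nilpotents R"
        if r: "r \<in> carrier R" and uvr: "u \<otimes> v \<otimes> r \<in> nilpotents R" for r
      proof -
        have "s \<otimes> a \<otimes> (v \<otimes> r) \<in> nilpotents R"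
          using uvr c r by (intro s) (auto simp: m_assoc)
        then have "v \<otimes> (r \<otimes> (s \<otimes> a)) \<in> nilpotents R"
          using nilpotent_commute[of "s \<otimes> a" "v \<otimes> r"] c a r by (simp add: m_assoc)
        then have "(t \<otimes> a \<otimes> r) \<otimes> (s \<otimes> a) \<in> nilpotents R"
          using t[of "r \<otimes> (s \<otimes> a)"] c a r by (simp add: m_assoc)
        then have "s \<otimes> (a \<otimes> (t \<otimes> a \<otimes> r)) \<in> nilpotents R"
          using nilpotent_commute[of "t \<otimes> a \<otimes> r" "s \<otimes> a"] c a r by (simp add: m_assoc)
        then have "(s \<otimes> t \<otimes> a) \<otimes> (t \<otimes> a \<otimes> r) \<in> nilpotents R"
          using nilpotent_insert[of s t "a \<otimes> (t \<otimes> a \<otimes> r)"] c a r by (simp add: m_assoc)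
        then have "(s \<otimes> t \<otimes> a) \<otimes> (r \<otimes> s) \<otimes> (t \<otimes> a \<otimes> r) \<in> nilpotents R"
          using nilpotent_insert c a r by simp
        then have "(s \<otimes> t \<otimes> a \<otimes> r) \<otimes> (s \<otimes> t \<otimes> a \<otimes> r) \<in> nilpotents R"
          using c a r by (simp add: m_assoc)
        from nilpotent_square[OF _ this] show ?thesis using c a r by simp
      qed
      moreover have "s \<otimes> t \<in> S" using st S(1) by (auto simp: avoiding_def)
      ultimately show ?thesis using c unfolding T_def by blast
    qed
    moreover have "T \<inter> nilpotents R = {}"
    proof -
      have False if u: "u \<in> T" "u \<in> nilpotents R" for u
      proof -
        obtain s where s: "s \<in> S"
          "\<And>r. r \<in> carrier R \<Longrightarrow> u \<otimes> r \<in> nilpotents R \<Longrightarrow> s \<otimes> a \<otimes> r \<in> nilpotents R"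
          using u(1) unfolding T_def by blast
        have "s \<otimes> a \<otimes> \<one> \<in> nilpotents R"
          using u(2) nilpotents_closed by (intro s(2)) auto
        with s(1) show False using no a Sc by simp
      qed
      then show ?thesis by blast
    qed
    moreover have "\<one> \<in> T" "T \<subseteq> carrier R"
      using \<open>S \<subseteq> T\<close> S(1) by (auto simp: avoiding_def) (simp add: T_def)
    ultimately have "avoiding T" by (simp add: avoiding_def)
    then show False using S(2) \<open>S \<subseteq> T\<close> \<open>a \<in> T\<close> aS by blast
  qed
qed

text \<open>\<open>P\<close> is the complement of a maximal \<open>S\<close> that contains
  \<open>c\<close>. The ideal properties follow from the description of \<open>P\<close> by
  multipliers in \<open>S\<close> and from insertion; primality is the multiplicativity of
  \<open>S\<close>. The last clause turns an inclusion of left annihilators into membership in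
  \<open>P\<close> and is the entry point for compatibility.\<close>

lemma separating_completely_prime:
  assumes "c \<in> carrier R" "c \<notin> nilpotents R"
  obtains P where "P \<subseteq> carrier R" "c \<notin> P" "\<zero> \<in> P" "\<one> \<notin> P"
    "\<And>a b. \<lbrakk>a \<in> P; b \<in> P\<rbrakk> \<Longrightarrow> a \<oplus> b \<in> P"
    "\<And>a r. \<lbrakk>a \<in> P; r \<in> carrier R\<rbrakk> \<Longrightarrow> r \<otimes> a \<in> P"
    "\<And>a r. \<lbrakk>a \<in> P; r \<in> carrier R\<rbrakk> \<Longrightarrow> a \<otimes> r \<in> P"
    "\<And>a b. \<lbrakk>a \<in> carrier R; b \<in> carrier R; a \<otimes> b \<in> P\<rbrakk> \<Longrightarrow> a \<in> P \<or> b \<in> P"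
    "\<And>a h. \<lbrakk>a \<in> P; h \<in> carrier R; \<And>y. \<lbrakk>y \<in> carrier R; y \<otimes> a = \<zero>\<rbrakk> \<Longrightarrow> y \<otimes> h = \<zero>\<rbrakk> \<Longrightarrow> h \<in> P"
proof -
  obtain S where S: "avoiding S" "c \<in> S" "\<And>T. \<lbrakk>avoiding T; S \<subseteq> T\<rbrakk> \<Longrightarrow> T = S"
    using maximal_avoiding[OF assms] by blast
  define P where "P = carrier R - S"
  have Sc: "\<And>s. s \<in> S \<Longrightarrow> s \<in> carrier R" and Sm: "\<And>s t. \<lbrakk>s \<in> S; t \<in> S\<rbrakk> \<Longrightarrow> s \<otimes> t \<in> S"
    using S(1) by (auto simp: avoiding_def)
  have P: "a \<in> P \<longleftrightarrow> a \<in> carrier R \<and> (\<exists>s \<in> S. s \<otimes> a \<in> nilpotents R)" for a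
    using maximal_avoiding_complement[OF S(1,3)] by (auto simp: P_def)
  show ?thesis
  proof (rule that)
    show "P \<subseteq> carrier R" "c \<notin> P" "\<one> \<notin> P" using S by (auto simp: P_def avoiding_def)
    show "\<zero> \<in> P" using S(1) zero_nilpotent by (auto simp: P_def avoiding_def)
  next
    fix a b assume "a \<in> P" "b \<in> P"
    then obtain s t where st: "s \<in> S" "t \<in> S" "s \<otimes> a \<in> nilpotents R" "t \<otimes> b \<in> nilpotents R"
      and ab: "a \<in> carrier R" "b \<in> carrier R" unfolding P by blast
    note c = ab st(1,2)[THEN Sc]
    \<comment> \<open>The product of the two multipliers serves as a common multiplier for both
      summands.\<close>
    have "s \<otimes> t \<otimes> a \<in> nilpotents R" "s \<otimes> (t \<otimes> b) \<in> nilpotents R"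
      using c st nilpotent_insert nilpotent_lmult by auto
    then have "s \<otimes> t \<otimes> (a \<oplus> b) \<in> nilpotents R"
      using c nilpotent_add by (simp add: r_distr m_assoc)
    then show "a \<oplus> b \<in> P" unfolding P using c Sm st by blast
  next
    fix a r assume a: "a \<in> P" and r: "r \<in> carrier R"
    then obtain s where s: "s \<in> S" "s \<otimes> a \<in> nilpotents R" and "a \<in> carrier R" unfolding P by blast
    note c = this(3) r s(1)[THEN Sc]
    have "s \<otimes> (r \<otimes> a) \<in> nilpotents R" "s \<otimes> (a \<otimes> r) \<in> nilpotents R"
      using nilpotent_insert[of s r a] nilpotent_rmult[of r "s \<otimes> a"] c s by (simp_all add: m_assoc)
    then show "r \<otimes> a \<in> P" "a \<otimes> r \<in> P" unfolding P using c s by auto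
  next
    fix a b assume "a \<in> carrier R" "b \<in> carrier R" "a \<otimes> b \<in> P"
    then show "a \<in> P \<or> b \<in> P" using Sm by (auto simp: P_def)
  next
    fix a h assume h: "a \<in> P" "h \<in> carrier R"
      "\<And>y. \<lbrakk>y \<in> carrier R; y \<otimes> a = \<zero>\<rbrakk> \<Longrightarrow> y \<otimes> h = \<zero>"
    then show "h \<in> P" unfolding P using nilpotent_replace[of _ a h] Sc by blast
  qed
qed

end

section \<open>Exponent vectors and weights\<close>

text \<open>Reduction modulo \<open>K\<close> recovers the lowest digit; cancelling it and dividing
  by \<open>K\<close> leaves a shorter numeral.\<close>

lemma sum_digits_inj:
  fixes a b :: "nat \<Rightarrow> nat"
  assumes "\<And>i. i < n \<Longrightarrow> a i < K" "\<And>i. i < n \<Longrightarrow> b i < K"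
    and "(\<Sum>i<n. a i * K ^ i) = (\<Sum>i<n. b i * K ^ i)" "i < n"
  shows "a i = b i"
  using assms
proof (induction n arbitrary: a b i)
  case (Suc n)
  have split: "(\<Sum>i<Suc n. d i * K ^ i) = d 0 + K * (\<Sum>i<n. d (Suc i) * K ^ i)" for d :: "nat \<Rightarrow> nat"
    by (simp only: sum.lessThan_Suc_shift) (simp add: sum_distrib_left ac_simps)
  have eq: "a 0 + K * (\<Sum>i<n. a (Suc i) * K ^ i) = b 0 + K * (\<Sum>i<n. b (Suc i) * K ^ i)"
    using Suc.prems(3) unfolding split .
  have lt: "a 0 < K" "b 0 < K" using Suc.prems(1,2) by auto
  have "a 0 = b 0" using arg_cong[OF eq, of "\<lambda>m. m mod K"] lt by simp
  moreover have "(\<Sum>i<n. a (Suc i) * K ^ i) = (\<Sum>i<n. b (Suc i) * K ^ i)"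
    using eq \<open>a 0 = b 0\<close> lt by simp
  then have "a (Suc j) = b (Suc j)" if "j < n" for j
    using Suc.IH[of "\<lambda>i. a (Suc i)" "\<lambda>i. b (Suc i)" j] Suc.prems(1,2) that by auto
  ultimately show ?case using Suc.prems(4) by (cases i) auto
qed simp

text \<open>Weights \<open>w i = B + K ^ i\<close> with \<open>K\<close> above all exponents in \<open>F\<close> make the total weight a
  base-\<open>K\<close> numeral; the shift \<open>B\<close>, itself a large power of \<open>K\<close>, makes all weights comparable.\<close>

lemma separating_weights:
  assumes "finite F" "F \<subseteq> exponents n"
  obtains w :: "nat \<Rightarrow> nat" where "\<And>i. w i > 0"
    "\<And>i j k. \<lbrakk>i \<le> n; j \<le> n; k \<le> n\<rbrakk> \<Longrightarrow> w k < w i + w j"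
    "inj_on (\<lambda>\<alpha>. \<Sum>i = 1..n. \<alpha> i * w i) F"
proof -
  \<comment> \<open>The two \<open>Suc\<close> give \<open>K \<ge> 2\<close> even for empty
    \<open>F\<close>, besides exceeding every exponent.\<close>
  define K where "K = Suc (Suc (\<Sum>\<alpha> \<in> F. \<Sum>i = 1..n. \<alpha> i))"
  define w where "w i = K ^ Suc n + K ^ i" for i
  have small: "\<alpha> i < K" if "\<alpha> \<in> F" for \<alpha> i
  proof (cases "i \<in> {1..n}")
    case True
    then have "\<alpha> i \<le> (\<Sum>i = 1..n. \<alpha> i)" by (intro member_le_sum) auto
    also have "\<dots> \<le> (\<Sum>\<alpha> \<in> F. \<Sum>i = 1..n. \<alpha> i)"
      using assms(1) that by (intro member_le_sum[of \<alpha> F "\<lambda>\<alpha>. \<Sum>i = 1..n. \<alpha> i"]) auto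
    finally show ?thesis by (simp add: K_def)
  next
    case False
    then show ?thesis using that assms(2) by (auto simp: exponents_def K_def)
  qed
  have K: "K \<ge> 2" by (simp add: K_def)
  show ?thesis
  proof (rule that[of w])
    show "w i > 0" for i using K by (simp add: w_def)
    fix i j k assume "k \<le> n"
    \<comment> \<open>Hence \<open>w k\<close> is at most \<open>2 * K ^ Suc n\<close>, which both
      summands of \<open>w i + w j\<close> together exceed.\<close>
    then have "K ^ k \<le> K ^ Suc n" using K by (intro power_increasing) auto
    moreover have "K ^ i > 0" using K by simp
    ultimately show "w k < w i + w j" unfolding w_def by linarith
  next
    \<comment> \<open>Exponents vanish at index 0, so the digit at position 0 can be added freely.
      The contribution of the shift is a multiple of \<open>K ^ Suc n\<close> and disappears on
      reduction modulo that power.\<close>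
    have num: "(\<Sum>i = 1..n. \<alpha> i * w i) =
        (\<Sum>i<Suc n. \<alpha> i * K ^ i) + K ^ Suc n * (\<Sum>i = 1..n. \<alpha> i)" if "\<alpha> \<in> F" for \<alpha>
    proof -
      have "\<alpha> 0 = 0" using that assms(2) by (auto simp: exponents_def)
      moreover have "{..<Suc n} = insert 0 {1..n}" by auto
      ultimately have "(\<Sum>i<Suc n. \<alpha> i * K ^ i) = (\<Sum>i = 1..n. \<alpha> i * K ^ i)" by simp
      then show ?thesis
        unfolding w_def by (simp add: distrib_left sum.distrib sum_distrib_left ac_simps)
    qed
    have bound: "(\<Sum>i<m. \<alpha> i * K ^ i) < K ^ m" if "\<alpha> \<in> F" for \<alpha> m
    proof (induction m)
      case (Suc m)
      have "Suc (\<alpha> m) * K ^ m \<le> K * K ^ m" using small[OF that, of m] by (intro mult_le_mono1) auto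
      then show ?case using Suc by simp
    qed simp
    show "inj_on (\<lambda>\<alpha>. \<Sum>i = 1..n. \<alpha> i * w i) F"
    proof (rule inj_onI)
      fix \<alpha> \<beta> assume F: "\<alpha> \<in> F" "\<beta> \<in> F"
        and "(\<Sum>i = 1..n. \<alpha> i * w i) = (\<Sum>i = 1..n. \<beta> i * w i)"
      then have "((\<Sum>i<Suc n. \<alpha> i * K ^ i) + K ^ Suc n * (\<Sum>i = 1..n. \<alpha> i)) mod K ^ Suc n =
          ((\<Sum>i<Suc n. \<beta> i * K ^ i) + K ^ Suc n * (\<Sum>i = 1..n. \<beta> i)) mod K ^ Suc n"
        using num[OF F(1)] num[OF F(2)] by simp
      then have "(\<Sum>i<Suc n. \<alpha> i * K ^ i) = (\<Sum>i<Suc n. \<beta> i * K ^ i)"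
        using bound[OF F(1), of "Suc n"] bound[OF F(2), of "Suc n"]
        by (simp only: mod_mult_self2 mod_less)
      then have "\<alpha> i = \<beta> i" if "i < Suc n" for i
        using sum_digits_inj[of "Suc n" \<alpha> K \<beta> i] small F that by blast
      moreover have "\<alpha> i = \<beta> i" if "\<not> i < Suc n" for i
        using that subsetD[OF assms(2) F(1)] subsetD[OF assms(2) F(2)] by (simp add: exponents_def)
      ultimately show "\<alpha> = \<beta>" by blast
    qed
  qed
qed

section \<open>Induction over exponent vectors and finite sums\<close>

lemma exponents_update: "\<lbrakk>\<alpha> \<in> exponents n; j \<in> {1..n}\<rbrakk> \<Longrightarrow> \<alpha>(j := k) \<in> exponents n"
  by (simp add: exponents_def)

text \<open>Induction on the total degree, lowering the exponent at the smallest index where it is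
  nonzero. The side condition on smaller indices fits \<open>monomial_step\<close>: the added
  variable is the leftmost factor of the ordered monomial.\<close>

lemma exponents_induct [consumes 1, case_names zero step]:
  assumes "\<alpha> \<in> exponents n"
    and zero: "Q (\<lambda>_. 0)"
    and step: "\<And>j \<beta>. \<lbrakk>j \<in> {1..n}; \<beta> \<in> exponents n; \<forall>k<j. \<beta> k = 0; Q \<beta>\<rbrakk> \<Longrightarrow> Q (\<beta>(j := Suc (\<beta> j)))"
  shows "Q \<alpha>"
  using assms(1)
proof (induction "\<Sum>i = 1..n. \<alpha> i" arbitrary: \<alpha> rule: less_induct)
  case less
  show ?case
  proof (cases "\<exists>i. \<alpha> i \<noteq> 0")
    case False
    then have "\<alpha> = (\<lambda>_. 0)" by auto
    then show ?thesis using zero by simp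
  next
    case True
    define j where "j = (LEAST i. \<alpha> i \<noteq> 0)"
    have j: "\<alpha> j \<noteq> 0" "\<forall>k<j. \<alpha> k = 0"
      unfolding j_def using True by (rule LeastI_ex, blast dest: not_less_Least)
    have jn: "j \<in> {1..n}" using j(1) less.prems by (auto simp: exponents_def)
    let ?\<beta> = "\<alpha>(j := \<alpha> j - 1)"
    have "(\<Sum>i = 1..n. ?\<beta> i) < (\<Sum>i = 1..n. \<alpha> i)"
      using j(1) jn by (intro sum_strict_mono_ex1) auto
    then have "Q (?\<beta>(j := Suc (?\<beta> j)))"
      using less exponents_update[OF less.prems jn] j jn by (intro step) auto
    then show ?thesis using j(1) by simp
  qed
qed

lemma (in abelian_monoid) finsum_induct:
  assumes "finite S" "F \<in> S \<rightarrow> carrier G" "Q \<zero>"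
    and "\<And>a b. \<lbrakk>a \<in> carrier G; b \<in> carrier G; Q a; Q b\<rbrakk> \<Longrightarrow> Q (a \<oplus> b)"
    and "\<And>i. i \<in> S \<Longrightarrow> Q (F i)"
  shows "Q (finsum G F S)"
  using assms(1,2,5)
proof (induction S)
  case empty
  then show ?case using assms(3) by simp
next
  case (insert i S)
  have "Q (F i)" "Q (finsum G F S)" using insert by auto
  then show ?case using insert assms(4) by (simp add: Pi_def)
qed

section \<open>Coefficients in a skew PBW extension\<close>

context skew_PBW_extension
begin

section \<open>Uniqueness of expansions and the coefficient functions\<close>

abbreviation "xpow \<equiv> monomial A n x"

lemma R_carrier: "r \<in> R \<Longrightarrow> r \<in> carrier A"
  using subringE(1)[OF subring] by blast

lemma monomial_closed: "\<alpha> \<in> exponents n \<Longrightarrow> xpow \<alpha> \<in> carrier A"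
  using basis by (auto simp: left_basis_def)

lemma combination_extend:
  assumes "finite T" "S \<subseteq> T" "T \<subseteq> exponents n" "c \<in> S \<rightarrow> R"
  shows "(\<Oplus>\<alpha> \<in> S. c \<alpha> \<otimes> xpow \<alpha>) = (\<Oplus>\<alpha> \<in> T. (if \<alpha> \<in> S then c \<alpha> else \<zero>) \<otimes> xpow \<alpha>)"
  using assms monomial_closed R_carrier
  by (intro add.finprod_mono_neutral_cong_left) (auto simp: Pi_def subset_iff)

lemma combination_unique:
  assumes "finite S" "S \<subseteq> exponents n" "c \<in> S \<rightarrow> R"
    and "finite S'" "S' \<subseteq> exponents n" "c' \<in> S' \<rightarrow> R"
    and eq: "(\<Oplus>\<alpha> \<in> S. c \<alpha> \<otimes> xpow \<alpha>) = (\<Oplus>\<alpha> \<in> S'. c' \<alpha> \<otimes> xpow \<alpha>)"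
  shows "(if \<alpha> \<in> S then c \<alpha> else \<zero>) = (if \<alpha> \<in> S' then c' \<alpha> else \<zero>)"
proof -
  define d where "d \<alpha> = (if \<alpha> \<in> S then c \<alpha> else \<zero>)" for \<alpha>
  define d' where "d' \<alpha> = (if \<alpha> \<in> S' then c' \<alpha> else \<zero>)" for \<alpha>
  let ?T = "S \<union> S'"
  have T: "finite ?T" "?T \<subseteq> exponents n" using assms by auto
  have dR: "d \<alpha> \<in> R" "d' \<alpha> \<in> R" for \<alpha>
    using assms subringE(2)[OF subring] by (auto simp: d_def d'_def)
  have diffR: "d \<alpha> \<ominus> d' \<alpha> \<in> R" for \<alpha>
    using dR subringE(5,7)[OF subring] by (simp add: a_minus_def)
  have m: "\<And>\<alpha>. \<alpha> \<in> ?T \<Longrightarrow> xpow \<alpha> \<in> carrier A" using T(2) monomial_closed by blast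
  \<comment> \<open>Instead of subtracting two sums, the second one is added to the sum of
    differences, which gives the first; cancellation then shows that the sum of differences is
    zero.\<close>
  have "(\<Oplus>\<alpha> \<in> ?T. (d \<alpha> \<ominus> d' \<alpha>) \<otimes> xpow \<alpha>) \<oplus> (\<Oplus>\<alpha> \<in> ?T. d' \<alpha> \<otimes> xpow \<alpha>)
      = (\<Oplus>\<alpha> \<in> ?T. (d \<alpha> \<ominus> d' \<alpha>) \<otimes> xpow \<alpha> \<oplus> d' \<alpha> \<otimes> xpow \<alpha>)"
    using m dR R_carrier by (subst finsum_addf) auto
  also have "\<dots> = (\<Oplus>\<alpha> \<in> ?T. d \<alpha> \<otimes> xpow \<alpha>)"
  proof (rule finsum_cong')
    fix \<alpha> assume "\<alpha> \<in> ?T"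
    note car = m[OF this] R_carrier[OF dR(1)[of \<alpha>]] R_carrier[OF dR(2)[of \<alpha>]]
    have "d \<alpha> \<ominus> d' \<alpha> \<oplus> d' \<alpha> = d \<alpha>" using car by algebra
    then show "(d \<alpha> \<ominus> d' \<alpha>) \<otimes> xpow \<alpha> \<oplus> d' \<alpha> \<otimes> xpow \<alpha> = d \<alpha> \<otimes> xpow \<alpha>"
      using car by (metis l_distr minus_closed)
  qed (use m dR R_carrier in auto)
  also have "\<dots> = (\<Oplus>\<alpha> \<in> ?T. d' \<alpha> \<otimes> xpow \<alpha>)"
    using combination_extend[OF T(1) _ T(2) assms(3)] combination_extend[OF T(1) _ T(2) assms(6)] eq
    unfolding d_def d'_def by simp
  finally have "(\<Oplus>\<alpha> \<in> ?T. (d \<alpha> \<ominus> d' \<alpha>) \<otimes> xpow \<alpha>) = \<zero>"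
    using m dR R_carrier by (subst (asm) add.r_cancel_one) (auto intro!: finsum_closed)
  then have "\<forall>\<alpha> \<in> ?T. d \<alpha> \<ominus> d' \<alpha> = \<zero>"
    using diffR by (intro basis_indep T) auto
  then have "\<forall>\<alpha> \<in> ?T. d \<alpha> = d' \<alpha>"
    using dR R_carrier r_right_minus_eq by blast
  then have "d \<alpha> = d' \<alpha>" by (cases "\<alpha> \<in> ?T") (auto simp: d_def d'_def)
  then show ?thesis by (simp only: d_def d'_def)
qed

text \<open>The choice ranges over all expansions of \<open>f\<close>. By
  \<open>combination_unique\<close> they give the same function once coefficients are extended by
  zero, so for \<open>f\<close> in the carrier the value is well defined.\<close>

definition coeff :: "'a \<Rightarrow> (nat \<Rightarrow> nat) \<Rightarrow> 'a" where
  "coeff f = (SOME k. \<exists>S c. finite S \<and> S \<subseteq> exponents n \<and> c \<in> S \<rightarrow> R \<and>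
     f = (\<Oplus>\<alpha> \<in> S. c \<alpha> \<otimes> xpow \<alpha>) \<and> k = (\<lambda>\<alpha>. if \<alpha> \<in> S then c \<alpha> else \<zero>))"

lemma coeff_combination:
  assumes "finite S" "S \<subseteq> exponents n" "c \<in> S \<rightarrow> R"
  shows "coeff (\<Oplus>\<alpha> \<in> S. c \<alpha> \<otimes> xpow \<alpha>) \<alpha> = (if \<alpha> \<in> S then c \<alpha> else \<zero>)"
proof -
  let ?f = "\<Oplus>\<alpha> \<in> S. c \<alpha> \<otimes> xpow \<alpha>"
  let ?Q = "\<lambda>k. \<exists>S' c'. finite S' \<and> S' \<subseteq> exponents n \<and> c' \<in> S' \<rightarrow> R \<and>
     ?f = (\<Oplus>\<alpha> \<in> S'. c' \<alpha> \<otimes> xpow \<alpha>) \<and> k = (\<lambda>\<alpha>. if \<alpha> \<in> S' then c' \<alpha> else \<zero>)"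
  have "?Q (\<lambda>\<alpha>. if \<alpha> \<in> S then c \<alpha> else \<zero>)"
    by (intro exI[of _ S] exI[of _ c]) (simp add: assms)
  then have "?Q (coeff ?f)" unfolding coeff_def by (rule someI[of ?Q])
  then obtain S' c' where *: "finite S'" "S' \<subseteq> exponents n" "c' \<in> S' \<rightarrow> R"
    "?f = (\<Oplus>\<alpha> \<in> S'. c' \<alpha> \<otimes> xpow \<alpha>)" "coeff ?f = (\<lambda>\<alpha>. if \<alpha> \<in> S' then c' \<alpha> else \<zero>)"
    by blast
  show ?thesis unfolding *(5) using combination_unique[OF assms *(1-4)] by simp
qed

lemma coeff_expansion:
  assumes "f \<in> carrier A"
  obtains S where "finite S" "S \<subseteq> exponents n" "\<And>\<alpha>. \<alpha> \<notin> S \<Longrightarrow> coeff f \<alpha> = \<zero>"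
    "\<And>\<alpha>. coeff f \<alpha> \<in> R" "f = (\<Oplus>\<alpha> \<in> S. coeff f \<alpha> \<otimes> xpow \<alpha>)"
proof -
  obtain S c where S: "finite S" "S \<subseteq> exponents n" "c \<in> S \<rightarrow> R"
    and f: "f = (\<Oplus>\<alpha> \<in> S. c \<alpha> \<otimes> xpow \<alpha>)"
    using basis assms unfolding left_basis_def by blast
  have c: "coeff f \<alpha> = (if \<alpha> \<in> S then c \<alpha> else \<zero>)" for \<alpha>
    unfolding f by (rule coeff_combination[OF S])
  show ?thesis
  proof (rule that[OF S(1,2)])
    show "f = (\<Oplus>\<alpha> \<in> S. coeff f \<alpha> \<otimes> xpow \<alpha>)"
      unfolding c using combination_extend[OF S(1) _ S(2,3)] f by simp
  qed (use c S(3) subringE(2)[OF subring] in auto)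
qed

lemma coeff_closed: "f \<in> carrier A \<Longrightarrow> coeff f \<alpha> \<in> R"
  using coeff_expansion by metis

lemma finite_support:
  assumes "f \<in> carrier A"
  shows "finite {\<alpha>. coeff f \<alpha> \<noteq> \<zero>}"
proof -
  obtain S where "finite S" "\<And>\<alpha>. \<alpha> \<notin> S \<Longrightarrow> coeff f \<alpha> = \<zero>"
    using coeff_expansion[OF assms] by metis
  then show ?thesis by (auto intro: finite_subset[of _ S])
qed

lemma support_exponents: "f \<in> carrier A \<Longrightarrow> {\<alpha>. coeff f \<alpha> \<noteq> \<zero>} \<subseteq> exponents n"
  by (rule coeff_expansion) auto

lemma coeff_add:
  assumes f: "f \<in> carrier A" and g: "g \<in> carrier A"
  shows "coeff (f \<oplus> g) \<alpha> = coeff f \<alpha> \<oplus> coeff g \<alpha>"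
proof -
  obtain S where S: "finite S" "S \<subseteq> exponents n" "\<And>\<alpha>. \<alpha> \<notin> S \<Longrightarrow> coeff f \<alpha> = \<zero>"
    "f = (\<Oplus>\<alpha> \<in> S. coeff f \<alpha> \<otimes> xpow \<alpha>)" using coeff_expansion[OF f] by metis
  obtain T where T: "finite T" "T \<subseteq> exponents n" "\<And>\<alpha>. \<alpha> \<notin> T \<Longrightarrow> coeff g \<alpha> = \<zero>"
    "g = (\<Oplus>\<alpha> \<in> T. coeff g \<alpha> \<otimes> xpow \<alpha>)" using coeff_expansion[OF g] by metis
  let ?U = "S \<union> T"
  have U: "finite ?U" "?U \<subseteq> exponents n" using S T by auto
  have ext: "h = (\<Oplus>\<alpha> \<in> ?U. coeff h \<alpha> \<otimes> xpow \<alpha>)"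
    if "h \<in> carrier A" "V \<subseteq> ?U" "\<And>\<alpha>. \<alpha> \<notin> V \<Longrightarrow> coeff h \<alpha> = \<zero>"
      "h = (\<Oplus>\<alpha> \<in> V. coeff h \<alpha> \<otimes> xpow \<alpha>)" for h V
  proof -
    have "h = (\<Oplus>\<alpha> \<in> ?U. (if \<alpha> \<in> V then coeff h \<alpha> else \<zero>) \<otimes> xpow \<alpha>)"
      using combination_extend[OF U(1) that(2) U(2), of "coeff h"] coeff_closed[OF that(1)] that(4)
      by simp
    moreover have "(if \<alpha> \<in> V then coeff h \<alpha> else \<zero>) = coeff h \<alpha>" for \<alpha> using that(3) by simp
    ultimately show ?thesis by simp
  qed
  have m: "\<And>\<alpha>. \<alpha> \<in> ?U \<Longrightarrow> xpow \<alpha> \<in> carrier A" using U(2) monomial_closed by blast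
  have R: "coeff f \<alpha> \<in> R" "coeff g \<alpha> \<in> R" for \<alpha> using coeff_closed f g by auto
  have "f \<oplus> g = (\<Oplus>\<alpha> \<in> ?U. coeff f \<alpha> \<otimes> xpow \<alpha>) \<oplus> (\<Oplus>\<alpha> \<in> ?U. coeff g \<alpha> \<otimes> xpow \<alpha>)"
    using ext[OF f _ S(3,4)] ext[OF g _ T(3,4)] by simp
  also have "\<dots> = (\<Oplus>\<alpha> \<in> ?U. coeff f \<alpha> \<otimes> xpow \<alpha> \<oplus> coeff g \<alpha> \<otimes> xpow \<alpha>)"
    using m R R_carrier by (subst finsum_addf) auto
  also have "\<dots> = (\<Oplus>\<alpha> \<in> ?U. (coeff f \<alpha> \<oplus> coeff g \<alpha>) \<otimes> xpow \<alpha>)"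
    using m R R_carrier by (intro finsum_cong') (auto simp: l_distr)
  finally have "coeff (f \<oplus> g) \<alpha> = (if \<alpha> \<in> ?U then coeff f \<alpha> \<oplus> coeff g \<alpha> else \<zero>)"
    using coeff_combination[OF U, of "\<lambda>\<alpha>. coeff f \<alpha> \<oplus> coeff g \<alpha>"] R subringE(7)[OF subring] by simp
  then show ?thesis using S(3) T(3) by simp
qed

lemma coeff_lmult:
  assumes r: "r \<in> R" and f: "f \<in> carrier A"
  shows "coeff (r \<otimes> f) \<alpha> = r \<otimes> coeff f \<alpha>"
proof -
  obtain S where S: "finite S" "S \<subseteq> exponents n" "\<And>\<alpha>. \<alpha> \<notin> S \<Longrightarrow> coeff f \<alpha> = \<zero>"
    "f = (\<Oplus>\<alpha> \<in> S. coeff f \<alpha> \<otimes> xpow \<alpha>)" using coeff_expansion[OF f] by metis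
  have m: "\<And>\<alpha>. \<alpha> \<in> S \<Longrightarrow> xpow \<alpha> \<in> carrier A" using S(2) monomial_closed by blast
  have R: "coeff f \<alpha> \<in> R" for \<alpha> using coeff_closed f by auto
  have "r \<otimes> f = (\<Oplus>\<alpha> \<in> S. r \<otimes> (coeff f \<alpha> \<otimes> xpow \<alpha>))"
    by (subst S(4), rule finsum_rdistr) (use S(1) m R r R_carrier in auto)
  also have "\<dots> = (\<Oplus>\<alpha> \<in> S. (r \<otimes> coeff f \<alpha>) \<otimes> xpow \<alpha>)"
    using m R r R_carrier by (intro finsum_cong') (auto simp: m_assoc)
  finally have "coeff (r \<otimes> f) \<alpha> = (if \<alpha> \<in> S then r \<otimes> coeff f \<alpha> else \<zero>)"
    using coeff_combination[OF S(1,2), of "\<lambda>\<alpha>. r \<otimes> coeff f \<alpha>"] r R subringE(6)[OF subring] by simp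
  then show ?thesis using S(3) r R_carrier by simp
qed

lemma coeff_monomial:
  assumes "r \<in> R" "\<beta> \<in> exponents n"
  shows "coeff (r \<otimes> xpow \<beta>) \<alpha> = (if \<alpha> = \<beta> then r else \<zero>)"
proof -
  have "(\<Oplus>\<alpha> \<in> {\<beta>}. r \<otimes> xpow \<alpha>) = r \<otimes> xpow \<beta>"
    using assms monomial_closed R_carrier by simp
  then show ?thesis using coeff_combination[of "{\<beta>}" "\<lambda>_. r" \<alpha>] assms by simp
qed

lemma coeff_zero: "coeff \<zero> \<alpha> = \<zero>"
  using coeff_combination[of "{}" "\<lambda>_. \<zero>" \<alpha>] by simp

lemma coeff_minus:
  assumes "f \<in> carrier A" "g \<in> carrier A"
  shows "coeff (f \<ominus> g) \<alpha> = coeff f \<alpha> \<ominus> coeff g \<alpha>"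
proof -
  have "\<ominus> g = (\<ominus> \<one>) \<otimes> g" using assms by (simp add: l_minus)
  moreover have "\<ominus> \<one> \<in> R" using subringE(3,5)[OF subring] by blast
  ultimately have "coeff (\<ominus> g) \<alpha> = (\<ominus> \<one>) \<otimes> coeff g \<alpha>" using coeff_lmult assms by simp
  then show ?thesis
    using assms coeff_add[of f "\<ominus> g"] R_carrier[OF coeff_closed[OF assms(2)]]
    by (simp add: a_minus_def l_minus)
qed

text \<open>The link to \<open>is_expansion\<close>, where summands are numbered rather than indexed
  by exponent vectors. Injectivity of \<open>\<alpha>\<close> permits reindexing.\<close>

lemma coeff_indexed:
  assumes "finite I" "inj_on \<alpha> I" "\<alpha> \<in> I \<rightarrow> exponents n" "a \<in> I \<rightarrow> R" "i \<in> I"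
  shows "coeff (\<Oplus>i \<in> I. a i \<otimes> xpow (\<alpha> i)) (\<alpha> i) = a i"
proof -
  let ?b = "a \<circ> the_inv_into I \<alpha>"
  have b: "?b (\<alpha> j) = a j" if "j \<in> I" for j using assms(2) that by (simp add: the_inv_into_f_f)
  have R: "?b \<in> \<alpha> ` I \<rightarrow> R" using b assms(4) by auto
  have summand: "a j \<otimes> xpow (\<alpha> j) \<in> carrier A" if "j \<in> I" for j
    using that assms(3,4) monomial_closed R_carrier by (simp add: Pi_iff)
  have "(\<Oplus>\<gamma> \<in> \<alpha> ` I. ?b \<gamma> \<otimes> xpow \<gamma>) = (\<Oplus>i \<in> I. ?b (\<alpha> i) \<otimes> xpow (\<alpha> i))"
    using assms(2) b summand by (intro finsum_reindex) auto
  also have "\<dots> = (\<Oplus>i \<in> I. a i \<otimes> xpow (\<alpha> i))"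
    using b summand by (intro finsum_cong') auto
  finally show ?thesis
    using coeff_combination[of "\<alpha> ` I" ?b "\<alpha> i"] assms R b by (auto simp del: o_apply)
qed

text \<open>If all exponents before \<open>j\<close> vanish, \<open>x j\<close> is leftmost in the
  ordered product, so left multiplication raises its exponent without any commutation.\<close>

lemma monomial_step:
  assumes j: "j \<in> {1..n}" and zero: "\<forall>k<j. \<beta> k = 0"
  shows "xpow (\<beta>(j := Suc (\<beta> j))) = x j \<otimes> xpow \<beta>"
proof -
  let ?F = "\<lambda>\<beta> i p. x i [^] (\<beta> i :: nat) \<otimes> p"
  have closed: "foldr (?F \<gamma>) is \<one> \<in> carrier A" if "set is \<subseteq> {1..n}" for \<gamma> "is"
    using that by (induction "is") (auto simp: x_in)
  have skip: "foldr (?F \<gamma>) is q = q" if "\<forall>i \<in> set is. \<gamma> i = 0" "q \<in> carrier A" for \<gamma> "is" q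
    using that by (induction "is") auto
  let ?Q = "foldr (?F \<beta>) [Suc j..<Suc n] \<one>"
  have Q: "?Q \<in> carrier A" using closed[of "[Suc j..<Suc n]"] j by fastforce
  have xj: "x j \<in> carrier A" using j x_in by simp
  have l: "[1..<Suc n] = [1..<j] @ j # [Suc j..<Suc n]"
  proof -
    have "[1..<Suc n] = [1..<j] @ [j..<Suc n]"
      using j upt_add_eq_append[of 1 j "Suc n - j"] by simp
    then show ?thesis using j by (simp only: upt_conv_Cons atLeastAtMost_iff less_Suc_eq_le)
  qed
  have split: "xpow \<gamma> = x j [^] \<gamma> j \<otimes> ?Q" if "\<forall>k<j. \<gamma> k = 0" "\<forall>k>j. \<gamma> k = \<beta> k" for \<gamma>
  proof -
    have "foldr (?F \<gamma>) [Suc j..<Suc n] \<one> = ?Q"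
      using that(2) by (intro foldr_cong) auto
    then show ?thesis
      unfolding monomial_def l using that(1) Q xj by (simp add: skip del: upt_Suc)
  qed
  have "xpow (\<beta>(j := Suc (\<beta> j))) = x j [^] Suc (\<beta> j) \<otimes> ?Q"
    using split[of "\<beta>(j := Suc (\<beta> j))"] zero by simp
  also have "\<dots> = x j \<otimes> (x j [^] \<beta> j \<otimes> ?Q)"
    unfolding nat_pow_Suc2[OF xj] using xj Q by (simp add: m_assoc)
  also have "\<dots> = x j \<otimes> xpow \<beta>" using split[of \<beta>] zero by simp
  finally show ?thesis .
qed

end

section \<open>Leading terms modulo a completely prime ideal\<close>

text \<open>Compatibility and reversibility enter through \<open>P\<close> and its stability under
  the families. By \<open>weight_less\<close> every variable weighs less than a product of two
  variables, so the linear remainders in the commutation relations have lower weight.\<close>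

locale weighted_prime = skew_PBW_extension +
  fixes \<sigma> \<delta> :: "nat \<Rightarrow> 'a \<Rightarrow> 'a" and P :: "'a set" and w :: "nat \<Rightarrow> nat"
  assumes families: "associated_families A R n x \<sigma> \<delta>"
    and P_subset: "P \<subseteq> R" and P_zero: "\<zero> \<in> P" and P_one: "\<one> \<notin> P"
    and P_add: "\<And>a b. \<lbrakk>a \<in> P; b \<in> P\<rbrakk> \<Longrightarrow> a \<oplus> b \<in> P"
    and P_lmult: "\<And>a r. \<lbrakk>a \<in> P; r \<in> R\<rbrakk> \<Longrightarrow> r \<otimes> a \<in> P"
    and P_rmult: "\<And>a r. \<lbrakk>a \<in> P; r \<in> R\<rbrakk> \<Longrightarrow> a \<otimes> r \<in> P"
    and P_prime: "\<And>a b. \<lbrakk>a \<in> R; b \<in> R; a \<otimes> b \<in> P\<rbrakk> \<Longrightarrow> a \<in> P \<or> b \<in> P"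
    and P_sigma: "\<And>i a. \<lbrakk>i \<in> {1..n}; a \<in> R\<rbrakk> \<Longrightarrow> \<sigma> i a \<in> P \<longleftrightarrow> a \<in> P"
    and P_delta: "\<And>i a. \<lbrakk>i \<in> {1..n}; a \<in> P\<rbrakk> \<Longrightarrow> \<delta> i a \<in> P"
    and weight_pos: "\<And>i. 0 < w i"
    and weight_less: "\<And>i j k. \<lbrakk>i \<in> {1..n}; j \<in> {1..n}; k \<in> {1..n}\<rbrakk> \<Longrightarrow> w k < w i + w j"
begin

section \<open>The weight filtration modulo \<open>P\<close>\<close>

definition weight :: "(nat \<Rightarrow> nat) \<Rightarrow> nat" where
  "weight \<alpha> = (\<Sum>i = 1..n. \<alpha> i * w i)"

text \<open>Modulo \<open>P\<close> these are the elements of weighted degree less than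
  \<open>d\<close>, expressed without forming a quotient. For \<open>d = 0\<close> all coefficients
  lie in \<open>P\<close>.\<close>

definition below :: "nat \<Rightarrow> 'a set" where
  "below d = {f \<in> carrier A. \<forall>\<alpha> \<in> exponents n. d \<le> weight \<alpha> \<longrightarrow> coeff f \<alpha> \<in> P}"

lemma weight_zero: "weight (\<lambda>_. 0) = 0"
  by (simp add: weight_def)

lemma weight_update:
  assumes "j \<in> {1..n}"
  shows "weight (\<alpha>(j := Suc (\<alpha> j))) = weight \<alpha> + w j"
proof -
  have "weight \<beta> = \<beta> j * w j + (\<Sum>i \<in> {1..n} - {j}. \<beta> i * w i)" for \<beta>
    unfolding weight_def using assms by (intro sum.remove) auto
  then show ?thesis by simp
qed

lemma R_mult: "\<lbrakk>a \<in> R; b \<in> R\<rbrakk> \<Longrightarrow> a \<otimes> b \<in> R"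
  using subringE(6)[OF subring] by blast

lemma R_minus: "a \<in> R \<Longrightarrow> \<ominus> a \<in> R"
  using subringE(5)[OF subring] by blast

lemma R_one: "\<one> \<in> R"
  using subringE(3)[OF subring] .

lemma P_R: "a \<in> P \<Longrightarrow> a \<in> R"
  using P_subset by blast

lemma P_minus: "a \<in> P \<Longrightarrow> \<ominus> a \<in> P"
  using P_lmult[of a "\<ominus> \<one>"] R_minus[OF R_one] R_carrier P_R by (simp add: l_minus)

lemma sigma_closed: "\<lbrakk>i \<in> {1..n}; r \<in> R\<rbrakk> \<Longrightarrow> \<sigma> i r \<in> R"
  using families by (auto simp: associated_families_def ring_hom_def)

lemma delta_closed: "\<lbrakk>i \<in> {1..n}; r \<in> R\<rbrakk> \<Longrightarrow> \<delta> i r \<in> R"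
  using families by (auto simp: associated_families_def skew_derivation_def)

lemma x_mult: "\<lbrakk>i \<in> {1..n}; r \<in> R\<rbrakk> \<Longrightarrow> x i \<otimes> r = \<sigma> i r \<otimes> x i \<oplus> \<delta> i r"
  using families by (auto simp: associated_families_def)

lemma x_mult_left:
  assumes "i \<in> {1..n}" "r \<in> R" "f \<in> carrier A"
  shows "x i \<otimes> (r \<otimes> f) = \<sigma> i r \<otimes> (x i \<otimes> f) \<oplus> \<delta> i r \<otimes> f"
proof -
  note car = assms(3) R_carrier[OF assms(2)] R_carrier[OF sigma_closed[OF assms(1,2)]]
    R_carrier[OF delta_closed[OF assms(1,2)]]
  have xi: "x i \<in> carrier A" using assms(1) x_in by simp
  have "x i \<otimes> (r \<otimes> f) = (x i \<otimes> r) \<otimes> f" using car xi by (simp add: m_assoc)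
  also have "\<dots> = \<sigma> i r \<otimes> (x i \<otimes> f) \<oplus> \<delta> i r \<otimes> f"
    unfolding x_mult[OF assms(1,2)] using car xi by (simp add: l_distr m_assoc)
  finally show ?thesis .
qed

lemma below_carrier: "f \<in> below d \<Longrightarrow> f \<in> carrier A"
  by (simp add: below_def)

lemma below_mono: "\<lbrakk>f \<in> below d; d \<le> e\<rbrakk> \<Longrightarrow> f \<in> below e"
  by (simp add: below_def)

lemma below_zero: "\<zero> \<in> below d"
  by (simp add: below_def coeff_zero P_zero)

lemma below_add: "\<lbrakk>f \<in> below d; g \<in> below d\<rbrakk> \<Longrightarrow> f \<oplus> g \<in> below d"
  by (simp add: below_def coeff_add P_add)

lemma below_lmult: "\<lbrakk>r \<in> R; f \<in> below d\<rbrakk> \<Longrightarrow> r \<otimes> f \<in> below d"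
  by (simp add: below_def coeff_lmult P_lmult R_carrier)

lemma below_P_mult: "\<lbrakk>p \<in> P; f \<in> carrier A\<rbrakk> \<Longrightarrow> p \<otimes> f \<in> below d"
  by (simp add: below_def coeff_lmult P_rmult P_R R_carrier coeff_closed)

lemma below_monomial:
  "\<lbrakk>r \<in> R; \<alpha> \<in> exponents n; weight \<alpha> < d \<or> r \<in> P\<rbrakk> \<Longrightarrow> r \<otimes> xpow \<alpha> \<in> below d"
  by (auto simp: below_def coeff_monomial R_carrier monomial_closed P_zero)

lemma xpow_below: "\<lbrakk>\<alpha> \<in> exponents n; weight \<alpha> < d\<rbrakk> \<Longrightarrow> xpow \<alpha> \<in> below d"
  using below_monomial[OF R_one] monomial_closed by fastforce

lemma below_induct [consumes 1, case_names zero add monomial]: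
  assumes f: "f \<in> below d"
    and "Q \<zero>" "\<And>f g. \<lbrakk>f \<in> carrier A; g \<in> carrier A; Q f; Q g\<rbrakk> \<Longrightarrow> Q (f \<oplus> g)"
    and mono: "\<And>r \<alpha>. \<lbrakk>r \<in> R; \<alpha> \<in> exponents n; weight \<alpha> < d \<or> r \<in> P\<rbrakk> \<Longrightarrow> Q (r \<otimes> xpow \<alpha>)"
  shows "Q f"
proof -
  obtain S where S: "finite S" "S \<subseteq> exponents n" "\<And>\<alpha>. coeff f \<alpha> \<in> R"
    and expand: "f = (\<Oplus>\<alpha> \<in> S. coeff f \<alpha> \<otimes> xpow \<alpha>)"
    using coeff_expansion[OF below_carrier[OF f]] by metis
  have "Q (\<Oplus>\<alpha> \<in> S. coeff f \<alpha> \<otimes> xpow \<alpha>)"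
  proof (rule finsum_induct[OF S(1) _ assms(2,3)])
    show "(\<lambda>\<alpha>. coeff f \<alpha> \<otimes> xpow \<alpha>) \<in> S \<rightarrow> carrier A"
      using S R_carrier monomial_closed by blast
    fix \<alpha> assume "\<alpha> \<in> S"
    then have E: "\<alpha> \<in> exponents n" using S(2) by blast
    then have "weight \<alpha> < d \<or> coeff f \<alpha> \<in> P"
      using f by (auto simp: below_def not_less)
    with E show "Q (coeff f \<alpha> \<otimes> xpow \<alpha>)" using mono S(3) by blast
  qed
  then show ?thesis using expand by simp
qed

text \<open>The bound for monomials is kept as an assumption so that the lemma can be used inside
  the induction that proves this bound, where \<open>H\<close> comes from the induction hypothesis,
  and again afterwards. Summands with coefficient in \<open>P\<close> are handled by the stability
  of \<open>P\<close>.\<close>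

lemma x_mult_below_if:
  assumes i: "i \<in> {1..n}" and f: "f \<in> below d"
    and H: "\<And>\<alpha>. \<lbrakk>\<alpha> \<in> exponents n; weight \<alpha> < d\<rbrakk> \<Longrightarrow> x i \<otimes> xpow \<alpha> \<in> below (d + w i)"
  shows "x i \<otimes> f \<in> below (d + w i)"
  using f
proof (induction rule: below_induct)
  case zero
  then show ?case using i x_in below_zero by simp
next
  case (add f g)
  then show ?case using i x_in below_add by (simp add: r_distr)
next
  case (monomial r \<alpha>)
  have xi: "x i \<in> carrier A" using i x_in by simp
  note m = monomial_closed[OF monomial(2)]
  show ?case
    unfolding x_mult_left[OF i monomial(1) m]
  proof (rule below_add)
    show "\<sigma> i r \<otimes> (x i \<otimes> xpow \<alpha>) \<in> below (d + w i)"
      using monomial(3)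
    proof
      assume "weight \<alpha> < d"
      then show ?thesis using below_lmult[OF sigma_closed] H monomial i by blast
    next
      assume "r \<in> P"
      then show ?thesis using below_P_mult P_sigma i monomial(1) xi m by simp
    qed
    show "\<delta> i r \<otimes> xpow \<alpha> \<in> below (d + w i)"
      using monomial i delta_closed P_delta by (intro below_monomial) auto
  qed
qed

lemma linear_part_mult_below:
  assumes "f \<in> linear_part A R n x" "g \<in> below d"
    and "\<And>k. k \<in> {1..n} \<Longrightarrow> x k \<otimes> g \<in> below d"
  shows "f \<otimes> g \<in> below d"
proof -
  obtain b r where br: "b \<in> R" "r \<in> {1..n} \<rightarrow> R"
    and f: "f = b \<oplus> (\<Oplus>k \<in> {1..n}. r k \<otimes> x k)"
    using assms(1) unfolding linear_part_def by blast
  note g = below_carrier[OF assms(2)]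
  have term_closed: "r k \<otimes> x k \<in> carrier A" "r k \<in> R" "x k \<in> carrier A" if "k \<in> {1..n}" for k
    using br(2) that R_carrier x_in by (auto simp: Pi_iff)
  have "(\<Oplus>k \<in> {1..n}. r k \<otimes> x k) \<otimes> g = (\<Oplus>k \<in> {1..n}. r k \<otimes> x k \<otimes> g)"
    using term_closed g by (intro finsum_ldistr) auto
  moreover have "(\<Oplus>k \<in> {1..n}. r k \<otimes> x k \<otimes> g) \<in> below d"
  proof (rule finsum_induct)
    fix k assume k: "k \<in> {1..n}"
    have "r k \<otimes> (x k \<otimes> g) \<in> below d" using below_lmult assms(3) term_closed k by simp
    then show "r k \<otimes> x k \<otimes> g \<in> below d"
      using term_closed[OF k] R_carrier g by (simp add: m_assoc)
  qed (use term_closed g below_zero below_add in auto)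
  moreover have "(\<Oplus>k \<in> {1..n}. r k \<otimes> x k) \<in> carrier A"
    using term_closed by (intro finsum_closed) auto
  ultimately show ?thesis
    unfolding f using br(1) R_carrier g below_add below_lmult assms(2) by (simp add: l_distr)
qed

section \<open>Left multiplication of a monomial by a variable\<close>

lemma x_eq_xpow: "i \<in> {1..n} \<Longrightarrow> x i = xpow ((\<lambda>_. 0)(i := Suc 0))"
  using monomial_step[of i "\<lambda>_. 0"] monomial_zero x_in by simp

lemma linear_part_below:
  assumes "f \<in> linear_part A R n x" "0 < d" "\<And>k. k \<in> {1..n} \<Longrightarrow> w k < d"
  shows "f \<in> below d"
proof -
  have zero: "(\<lambda>_. 0) \<in> exponents n" by (simp add: exponents_def)
  have one: "\<one> \<in> below d" using xpow_below[OF zero] weight_zero assms(2) monomial_zero by simp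
  have "x k \<in> below d" if "k \<in> {1..n}" for k
  proof -
    have "weight ((\<lambda>_. 0)(k := Suc 0)) = w k"
      using weight_update[OF that, of "\<lambda>_. 0"] weight_zero by simp
    then show ?thesis
      using xpow_below[OF exponents_update[OF zero that, of "Suc 0"]] assms(3)[OF that]
      by (simp add: x_eq_xpow[OF that])
  qed
  then have "f \<otimes> \<one> \<in> below d"
    using x_in by (intro linear_part_mult_below[OF assms(1) one]) auto
  moreover have "f \<in> carrier A"
    using assms(1) R_carrier x_in unfolding linear_part_def
    by (auto simp: Pi_iff intro!: add.m_closed finsum_closed)
  ultimately show ?thesis by simp
qed

text \<open>The two relations for \<open>x\<^sub>i x\<^sub>j\<close> and \<open>x\<^sub>j x\<^sub>i\<close> combine to \<open>1 - c\<^sub>i\<^sub>,\<^sub>j c\<^sub>j\<^sub>,\<^sub>i \<in> P\<close>.\<close>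

lemma commutation_coeff_notin:
  assumes ij: "i \<in> {1..n}" "j \<in> {1..n}" "j < i" and c: "c \<in> R"
    and rel: "x i \<otimes> x j \<ominus> c \<otimes> (x j \<otimes> x i) \<in> linear_part A R n x"
  shows "c \<notin> P"
proof
  assume cP: "c \<in> P"
  obtain c' where c': "c' \<in> R" "x j \<otimes> x i \<ominus> c' \<otimes> (x i \<otimes> x j) \<in> linear_part A R n x"
    using x_x[OF ij(1,2)] by blast
  let ?e = "(\<lambda>_. 0)(i := Suc 0) :: nat \<Rightarrow> nat"
  let ?\<epsilon> = "?e(j := Suc (?e j))" and ?u = "x j \<otimes> x i" and ?v = "x i \<otimes> x j"
  have e: "?e \<in> exponents n" using ij by (simp add: exponents_def)
  have \<epsilon>: "?\<epsilon> \<in> exponents n" using exponents_update[OF e ij(2)] .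
  have weight: "weight ?\<epsilon> = w i + w j"
    using weight_update[OF ij(2), of ?e] weight_update[OF ij(1), of "\<lambda>_. 0"] weight_zero by simp
  have u: "?u = xpow ?\<epsilon>"
    using monomial_step[OF ij(2), of ?e] ij(3) x_eq_xpow[OF ij(1)] by simp
  have car: "x i \<in> carrier A" "x j \<in> carrier A" "c \<in> carrier A" "c' \<in> carrier A"
    using ij x_in c c' R_carrier by auto
  have small: "0 < w i + w j" "\<And>k. k \<in> {1..n} \<Longrightarrow> w k < w i + w j"
    using weight_pos weight_less ij by auto
  \<comment> \<open>In this combination \<open>?v\<close> cancels, leaving a multiple of the ordered
    monomial \<open>?u\<close>. Both remainders are linear and thus lie below its weight, which puts
    the coefficient of \<open>?u\<close> in \<open>P\<close>.\<close>
  have "(?u \<ominus> c' \<otimes> ?v) \<oplus> c' \<otimes> (?v \<ominus> c \<otimes> ?u) \<in> below (w i + w j)"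
    using linear_part_below[OF rel small] linear_part_below[OF c'(2) small] c'(1)
    by (intro below_add below_lmult)
  moreover have "(?u \<ominus> c' \<otimes> ?v) \<oplus> c' \<otimes> (?v \<ominus> c \<otimes> ?u) = (\<one> \<ominus> c' \<otimes> c) \<otimes> ?u"
    using car by algebra
  ultimately have "(\<one> \<ominus> c' \<otimes> c) \<otimes> xpow ?\<epsilon> \<in> below (w i + w j)" using u by simp
  moreover have "\<one> \<ominus> c' \<otimes> c \<in> R"
    using R_one R_mult R_minus c c' subringE(7)[OF subring] by (simp add: a_minus_def)
  ultimately have "\<one> \<ominus> c' \<otimes> c \<in> P"
    using \<epsilon> weight by (auto simp: below_def coeff_monomial)
  then have "\<one> \<ominus> c' \<otimes> c \<oplus> c' \<otimes> c \<in> P" using P_add P_lmult cP c' by blast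
  moreover have "\<one> \<ominus> c' \<otimes> c \<oplus> c' \<otimes> c = \<one>" using car by algebra
  ultimately show False using P_one by simp
qed

text \<open>Sorting \<open>x\<^sub>i\<close> past a leading \<open>x\<^sub>j\<close> with \<open>j < i\<close> leaves only products \<open>x\<^sub>k x\<^sup>\<gamma>\<close> of smaller total
  weight, to which the induction hypothesis applies; summands with coefficient in \<open>P\<close> may have
  any weight, since the elements with all coefficients in \<open>P\<close> form an ideal.\<close>

lemma x_mult_xpow:
  assumes "i \<in> {1..n}" "\<beta> \<in> exponents n"
  shows "\<exists>c l. c \<in> R \<and> c \<notin> P \<and> l \<in> below (weight \<beta> + w i) \<and>
    x i \<otimes> xpow \<beta> = c \<otimes> xpow (\<beta>(i := Suc (\<beta> i))) \<oplus> l"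
  using assms
proof (induction "weight \<beta> + w i" arbitrary: i \<beta> rule: less_induct)
  case less
  note i = less.prems(1) and \<beta> = less.prems(2)
  let ?m = "weight \<beta> + w i"
  have xc: "x k \<in> carrier A" if "k \<in> {1..n}" for k using that x_in by simp
  \<comment> \<open>The \<open>Suc\<close> makes room for the leading term, whose weight is exactly
    \<open>weight \<gamma> + w k\<close>.\<close>
  have small: "x k \<otimes> xpow \<gamma> \<in> below (Suc (weight \<gamma> + w k))"
    if lt: "weight \<gamma> + w k < ?m" and k: "k \<in> {1..n}" and \<gamma>: "\<gamma> \<in> exponents n" for k \<gamma>
  proof -
    obtain c l where "c \<in> R" "l \<in> below (weight \<gamma> + w k)"
      "x k \<otimes> xpow \<gamma> = c \<otimes> xpow (\<gamma>(k := Suc (\<gamma> k))) \<oplus> l"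
      using less.hyps[OF lt k \<gamma>] by blast
    then show ?thesis
      using below_mono[of l] below_monomial[of c "\<gamma>(k := Suc (\<gamma> k))"] exponents_update[OF \<gamma> k]
        weight_update[OF k]
      by (auto intro!: below_add)
  qed
  have small_below: "x k \<otimes> f \<in> below ?m"
    if f: "f \<in> below d" and k: "k \<in> {1..n}" and d: "d + w k \<le> ?m" for f k d
  proof -
    have "x k \<otimes> xpow \<alpha> \<in> below (d + w k)" if "\<alpha> \<in> exponents n" "weight \<alpha> < d" for \<alpha>
      using that d by (intro below_mono[OF small]) (use k in auto)
    from below_mono[OF x_mult_below_if[OF k f this] d] show ?thesis .
  qed
  show ?case
  proof (cases "\<forall>k<i. \<beta> k = 0")
    case True
    have "\<beta>(i := Suc (\<beta> i)) \<in> exponents n" using exponents_update[OF \<beta> i] .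
    then have "x i \<otimes> xpow \<beta> = \<one> \<otimes> xpow (\<beta>(i := Suc (\<beta> i))) \<oplus> \<zero>"
      using monomial_step[OF i True] monomial_closed[OF \<beta>] i x_in by simp
    then show ?thesis using R_one P_one below_zero by blast
  next
    case False
    \<comment> \<open>The induction rule acts here as a case distinction that splits off the
      leftmost variable of \<open>xpow \<beta>\<close>; the zero vector is excluded by
      \<open>False\<close>.\<close>
    obtain j \<beta>' where j: "j \<in> {1..n}" and \<beta>': "\<beta>' \<in> exponents n" "\<forall>k<j. \<beta>' k = 0"
      and eq: "\<beta> = \<beta>'(j := Suc (\<beta>' j))"
      using \<beta> False by (induction rule: exponents_induct) auto
    have ji: "j < i"
    proof (rule ccontr)
      assume "\<not> j < i"
      then show False using False \<beta>'(2) eq by auto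
    qed
    let ?\<gamma> = "\<beta>'(i := Suc (\<beta>' i))" and ?\<epsilon> = "\<beta>(i := Suc (\<beta> i))"
    have \<gamma>: "?\<gamma> \<in> exponents n" using exponents_update[OF \<beta>'(1) i] .
    have \<epsilon>: "?\<epsilon> \<in> exponents n" using exponents_update[OF \<beta> i] .
    have m: "?m = weight \<beta>' + w j + w i" using weight_update[OF j, of \<beta>'] eq by simp
    have xj_xpow: "x j \<otimes> xpow ?\<gamma> = xpow ?\<epsilon>"
    proof -
      have "?\<epsilon> = ?\<gamma>(j := Suc (?\<gamma> j))" using ji eq by auto
      then show ?thesis using monomial_step[OF j, of ?\<gamma>] \<beta>'(2) ji by simp
    qed
    obtain c where c: "c \<in> R" and rel: "x i \<otimes> x j \<ominus> c \<otimes> (x j \<otimes> x i) \<in> linear_part A R n x"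
      using x_x[OF j i] by blast
    note cP = commutation_coeff_notin[OF i j ji c rel]
    have "weight \<beta>' + w i < ?m" using m weight_pos[of j] by simp
    from less.hyps[OF this i \<beta>'(1)] obtain c' l' where c': "c' \<in> R" "c' \<notin> P"
      and l': "l' \<in> below (weight \<beta>' + w i)" "x i \<otimes> xpow \<beta>' = c' \<otimes> xpow ?\<gamma> \<oplus> l'" by blast
    let ?L = "x i \<otimes> x j \<ominus> c \<otimes> (x j \<otimes> x i)"
    note car = xc[OF i] xc[OF j] R_carrier[OF c] R_carrier[OF c'(1)] below_carrier[OF l'(1)]
      monomial_closed[OF \<beta>'(1)] monomial_closed[OF \<gamma>] monomial_closed[OF \<epsilon>]
      R_carrier[OF sigma_closed[OF j c'(1)]] R_carrier[OF delta_closed[OF j c'(1)]]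
    \<comment> \<open>Since \<open>w k < w i + w j\<close>, each product of \<open>x k\<close> with
      \<open>xpow \<beta>'\<close> falls under the induction hypothesis.\<close>
    have \<lambda>: "?L \<otimes> xpow \<beta>' \<in> below ?m"
    proof (rule linear_part_mult_below[OF rel])
      show "xpow \<beta>' \<in> below ?m" using xpow_below[OF \<beta>'(1)] m weight_pos[of j] by simp
      fix k assume k: "k \<in> {1..n}"
      then have "weight \<beta>' + w k < ?m" using m weight_less[OF j i k] by simp
      then show "x k \<otimes> xpow \<beta>' \<in> below ?m" using small[OF _ k \<beta>'(1)] below_mono by fastforce
    qed
    let ?r = "c \<otimes> (\<delta> j c' \<otimes> xpow ?\<gamma> \<oplus> x j \<otimes> l') \<oplus> ?L \<otimes> xpow \<beta>'"
    have xl': "x j \<otimes> l' \<in> below ?m" using small_below[OF l'(1) j] m by simp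
    have \<delta>c': "\<delta> j c' \<otimes> xpow ?\<gamma> \<in> below ?m"
      using m weight_pos[of j] weight_update[OF i, of \<beta>'] delta_closed[OF j c'(1)] \<gamma>
      by (intro below_monomial) auto
    have r: "?r \<in> below ?m"
      by (rule below_add[OF below_lmult[OF c below_add[OF \<delta>c' xl']] \<lambda>])
    have "xpow \<beta> = x j \<otimes> xpow \<beta>'" using monomial_step[OF j \<beta>'(2)] eq by simp
    then have "x i \<otimes> xpow \<beta> = (x i \<otimes> x j) \<otimes> xpow \<beta>'" using car by (simp add: m_assoc)
    \<comment> \<open>Here \<open>x i \<otimes> x j\<close> is exchanged for
      \<open>c \<otimes> (x j \<otimes> x i)\<close> plus the linear remainder
      \<open>?L\<close>.\<close>
    also have "\<dots> = c \<otimes> (x j \<otimes> (x i \<otimes> xpow \<beta>')) \<oplus> ?L \<otimes> xpow \<beta>'"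
      using car by algebra
    also have "x j \<otimes> (x i \<otimes> xpow \<beta>') = \<sigma> j c' \<otimes> xpow ?\<epsilon> \<oplus> \<delta> j c' \<otimes> xpow ?\<gamma> \<oplus> x j \<otimes> l'"
      unfolding l'(2) using car x_mult_left[OF j c'(1), of "xpow ?\<gamma>"] xj_xpow
      by (simp add: r_distr)
    also have "c \<otimes> (\<sigma> j c' \<otimes> xpow ?\<epsilon> \<oplus> \<delta> j c' \<otimes> xpow ?\<gamma> \<oplus> x j \<otimes> l') \<oplus> ?L \<otimes> xpow \<beta>'
        = (c \<otimes> \<sigma> j c') \<otimes> xpow ?\<epsilon> \<oplus> ?r"
      using car by algebra
    finally have "x i \<otimes> xpow \<beta> = (c \<otimes> \<sigma> j c') \<otimes> xpow ?\<epsilon> \<oplus> ?r" .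
    \<comment> \<open>The leading coefficient stays outside \<open>P\<close> because
      \<open>c\<close> and \<open>c'\<close> do, \<open>\<sigma> j\<close> preserves and reflects
      membership in \<open>P\<close>, and \<open>P\<close> is completely prime.\<close>
    moreover have "c \<otimes> \<sigma> j c' \<in> R" "c \<otimes> \<sigma> j c' \<notin> P"
      using R_mult c sigma_closed[OF j c'(1)] P_prime cP P_sigma[OF j c'(1)] c'(2) by blast+
    ultimately show ?thesis using r by blast
  qed
qed

lemma x_mult_below:
  assumes i: "i \<in> {1..n}" and f: "f \<in> below d"
  shows "x i \<otimes> f \<in> below (d + w i)"
proof (rule x_mult_below_if[OF i f])
  fix \<alpha> assume \<alpha>: "\<alpha> \<in> exponents n" "weight \<alpha> < d"
  obtain c l where cl: "c \<in> R" "l \<in> below (weight \<alpha> + w i)"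
    "x i \<otimes> xpow \<alpha> = c \<otimes> xpow (\<alpha>(i := Suc (\<alpha> i))) \<oplus> l"
    using x_mult_xpow[OF i \<alpha>(1)] by blast
  have "c \<otimes> xpow (\<alpha>(i := Suc (\<alpha> i))) \<in> below (d + w i)"
    using cl(1) \<alpha> weight_update[OF i] exponents_update[OF \<alpha>(1) i] by (intro below_monomial) auto
  then show "x i \<otimes> xpow \<alpha> \<in> below (d + w i)"
    unfolding cl(3) using below_mono[OF cl(2)] \<alpha>(2) by (intro below_add) auto
qed

section \<open>Weights of products\<close>

lemma xpow_mult_below:
  assumes "\<alpha> \<in> exponents n" and f: "f \<in> below d"
  shows "xpow \<alpha> \<otimes> f \<in> below (d + weight \<alpha>)"
  using assms(1)
proof (induction rule: exponents_induct)
  case zero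
  then show ?case using f below_carrier monomial_zero weight_zero by simp
next
  case (step j \<beta>)
  have "x j \<otimes> (xpow \<beta> \<otimes> f) \<in> below (d + weight \<beta> + w j)"
    by (rule x_mult_below[OF step(1,4)])
  then show ?case
    unfolding monomial_step[OF step(1,3)] weight_update[OF step(1)]
    using x_in step(1) monomial_closed[OF step(2)] below_carrier[OF f] by (simp add: m_assoc add.assoc)
qed

text \<open>Moving \<open>x j\<close> past the current coefficient \<open>c\<close> turns it into
  \<open>\<sigma> j c\<close>, up to a term of lower weight, and \<open>x_mult_xpow\<close>
  contributes a further factor outside \<open>P\<close>. Complete primality keeps the product of the
  two outside \<open>P\<close>.\<close>

lemma xpow_mult_xpow:
  assumes "\<alpha> \<in> exponents n" and \<beta>: "\<beta> \<in> exponents n" and b: "b \<in> R" "b \<notin> P"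
  shows "\<exists>c l. c \<in> R \<and> c \<notin> P \<and> l \<in> below (weight \<alpha> + weight \<beta>) \<and>
    xpow \<alpha> \<otimes> (b \<otimes> xpow \<beta>) = c \<otimes> xpow (\<lambda>k. \<alpha> k + \<beta> k) \<oplus> l"
  using assms(1)
proof (induction rule: exponents_induct)
  case zero
  show ?case
    using b \<beta> R_carrier monomial_closed monomial_zero below_zero
    by (intro exI[of _ b] exI[of _ \<zero>]) simp
next
  case (step j \<alpha>)
  note j = step(1)
  let ?\<gamma> = "\<lambda>k. \<alpha> k + \<beta> k"
  obtain c l where c: "c \<in> R" "c \<notin> P" and l: "l \<in> below (weight \<alpha> + weight \<beta>)"
    "xpow \<alpha> \<otimes> (b \<otimes> xpow \<beta>) = c \<otimes> xpow ?\<gamma> \<oplus> l" using step(4) by blast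
  have \<gamma>: "?\<gamma> \<in> exponents n" using step(2) \<beta> by (simp add: exponents_def)
  have wt: "weight ?\<gamma> = weight \<alpha> + weight \<beta>"
    by (simp add: weight_def distrib_right sum.distrib)
  obtain c' l' where c': "c' \<in> R" "c' \<notin> P" and l': "l' \<in> below (weight ?\<gamma> + w j)"
    "x j \<otimes> xpow ?\<gamma> = c' \<otimes> xpow (?\<gamma>(j := Suc (?\<gamma> j))) \<oplus> l'"
    using x_mult_xpow[OF j \<gamma>] by blast
  have \<epsilon>: "?\<gamma>(j := Suc (?\<gamma> j)) = (\<lambda>k. (\<alpha>(j := Suc (\<alpha> j))) k + \<beta> k)" by auto
  let ?\<epsilon> = "?\<gamma>(j := Suc (?\<gamma> j))" and ?m = "weight \<alpha> + weight \<beta> + w j"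
  have xj: "x j \<in> carrier A" using j x_in by simp
  note car = xj R_carrier[OF c(1)] R_carrier[OF c'(1)] R_carrier[OF b(1)] below_carrier[OF l(1)]
    below_carrier[OF l'(1)] monomial_closed[OF \<beta>] monomial_closed[OF \<gamma>] monomial_closed[OF step(2)]
    monomial_closed[OF exponents_update[OF \<gamma> j]]
    R_carrier[OF sigma_closed[OF j c(1)]] R_carrier[OF delta_closed[OF j c(1)]]
  let ?r = "\<sigma> j c \<otimes> l' \<oplus> \<delta> j c \<otimes> xpow ?\<gamma> \<oplus> x j \<otimes> l"
  have "\<sigma> j c \<otimes> l' \<in> below ?m"
    using below_lmult[OF sigma_closed[OF j c(1)] l'(1)] wt by simp
  moreover have "\<delta> j c \<otimes> xpow ?\<gamma> \<in> below ?m"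
    using delta_closed[OF j c(1)] \<gamma> wt weight_pos by (intro below_monomial) auto
  ultimately have r: "?r \<in> below ?m" using x_mult_below[OF j l(1)] by (intro below_add)
  have "xpow (\<alpha>(j := Suc (\<alpha> j))) \<otimes> (b \<otimes> xpow \<beta>) = x j \<otimes> (xpow \<alpha> \<otimes> (b \<otimes> xpow \<beta>))"
    unfolding monomial_step[OF j step(3)] using car by (simp add: m_assoc)
  also have "\<dots> = \<sigma> j c \<otimes> (c' \<otimes> xpow ?\<epsilon> \<oplus> l') \<oplus> \<delta> j c \<otimes> xpow ?\<gamma> \<oplus> x j \<otimes> l"
    unfolding l(2) using car x_mult_left[OF j c(1), of "xpow ?\<gamma>"] l'(2) by (simp add: r_distr)
  also have "\<dots> = (\<sigma> j c \<otimes> c') \<otimes> xpow ?\<epsilon> \<oplus> ?r"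
    using car by (simp add: r_distr m_assoc a_ac)
  finally have eq: "xpow (\<alpha>(j := Suc (\<alpha> j))) \<otimes> (b \<otimes> xpow \<beta>) = (\<sigma> j c \<otimes> c') \<otimes> xpow ?\<epsilon> \<oplus> ?r" .
  have c'': "\<sigma> j c \<otimes> c' \<in> R" "\<sigma> j c \<otimes> c' \<notin> P"
    using R_mult c'(1) sigma_closed[OF j c(1)] P_prime P_sigma[OF j c(1)] c(2) c'(2) by blast+
  have wt': "weight (\<alpha>(j := Suc (\<alpha> j))) + weight \<beta> = ?m" using weight_update[OF j] by simp
  show ?case
    unfolding \<epsilon>[symmetric] wt'
    by (intro exI[of _ "\<sigma> j c \<otimes> c'"] exI[of _ ?r] conjI) (fact c'' r eq)+
qed

text \<open>Modulo \<open>P\<close>, \<open>Suc d\<close> bounds the weights of \<open>f\<close> by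
  \<open>d\<close> inclusively, while the bound for \<open>g\<close> is strict. One strict bound
  suffices for a strict bound on the product.\<close>

lemma mult_below:
  assumes f: "f \<in> below (Suc d)" and g: "g \<in> below e"
  shows "f \<otimes> g \<in> below (d + e)"
  using f
proof (induction rule: below_induct)
  case zero
  then show ?case using below_carrier[OF g] below_zero by simp
next
  case (add f h)
  then show ?case using below_carrier[OF g] below_add by (simp add: l_distr)
next
  case (monomial r \<alpha>)
  note car = R_carrier[OF monomial(1)] monomial_closed[OF monomial(2)] below_carrier[OF g]
  have "r \<otimes> (xpow \<alpha> \<otimes> g) \<in> below (d + e)"
    using monomial(3)
  proof
    assume "weight \<alpha> < Suc d"
    then have "xpow \<alpha> \<otimes> g \<in> below (d + e)"
      using below_mono[OF xpow_mult_below[OF monomial(2) g]] by simp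
    then show ?thesis using below_lmult monomial(1) by blast
  qed (use car below_P_mult in auto)
  then show ?case using car by (simp add: m_assoc)
qed

lemma below_0_mult:
  assumes f: "f \<in> below 0" and g: "g \<in> carrier A"
  shows "f \<otimes> g \<in> below d"
  using f
proof (induction rule: below_induct)
  case (monomial r \<alpha>)
  then show ?case
    using g below_P_mult[of r "xpow \<alpha> \<otimes> g"] R_carrier monomial_closed by (simp add: m_assoc)
qed (use g below_zero below_add in \<open>simp_all add: l_distr\<close>)

text \<open>The counterpart of \<open>mult_below\<close> with the strict bound on the left. For
  \<open>d = 0\<close> there is no predecessor to use; then all coefficients of \<open>f\<close> lie
  in \<open>P\<close>, and \<open>below_0_mult\<close> applies.\<close>

lemma mult_below':
  assumes "f \<in> below d" "g \<in> below (Suc e)"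
  shows "f \<otimes> g \<in> below (d + e)"
proof (cases d)
  case 0
  then show ?thesis using assms below_0_mult below_carrier by blast
next
  case (Suc d')
  then show ?thesis using mult_below[of f d' g "Suc e"] assms by simp
qed

section \<open>Leading terms and nonnilpotent products\<close>

definition leading :: "'a \<Rightarrow> (nat \<Rightarrow> nat) \<Rightarrow> bool" where
  "leading f \<alpha> \<longleftrightarrow> \<alpha> \<in> exponents n \<and>
     (\<exists>a l. a \<in> R \<and> a \<notin> P \<and> l \<in> below (weight \<alpha>) \<and> f = a \<otimes> xpow \<alpha> \<oplus> l)"

text \<open>The leading terms multiply by \<open>xpow_mult_xpow\<close>, and every other product
  contains a factor of strictly smaller weight modulo \<open>P\<close>. The weight may fail to
  separate the exponents of the product: the remainder is controlled by weight alone, so the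
  argument iterates to powers.\<close>

lemma leading_mult:
  assumes "leading f \<alpha>" "leading g \<beta>"
  shows "leading (f \<otimes> g) (\<lambda>k. \<alpha> k + \<beta> k)"
proof -
  obtain a l where a: "\<alpha> \<in> exponents n" "a \<in> R" "a \<notin> P" "l \<in> below (weight \<alpha>)" "f = a \<otimes> xpow \<alpha> \<oplus> l"
    using assms(1) unfolding leading_def by blast
  obtain b m where b: "\<beta> \<in> exponents n" "b \<in> R" "b \<notin> P" "m \<in> below (weight \<beta>)" "g = b \<otimes> xpow \<beta> \<oplus> m"
    using assms(2) unfolding leading_def by blast
  obtain c p where c: "c \<in> R" "c \<notin> P" "p \<in> below (weight \<alpha> + weight \<beta>)"
    "xpow \<alpha> \<otimes> (b \<otimes> xpow \<beta>) = c \<otimes> xpow (\<lambda>k. \<alpha> k + \<beta> k) \<oplus> p"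
    using xpow_mult_xpow[OF a(1) b(1-3)] by blast
  have s: "(\<lambda>k. \<alpha> k + \<beta> k) \<in> exponents n" using a(1) b(1) by (simp add: exponents_def)
  have wt: "weight (\<lambda>k. \<alpha> k + \<beta> k) = weight \<alpha> + weight \<beta>"
    by (simp add: weight_def distrib_right sum.distrib)
  have ax: "a \<otimes> xpow \<alpha> \<in> below (Suc (weight \<alpha>))" "b \<otimes> xpow \<beta> \<in> below (Suc (weight \<beta>))"
    using a b by (auto intro: below_monomial)
  have g: "g \<in> below (Suc (weight \<beta>))"
    unfolding b(5) using ax(2) below_mono[OF b(4)] by (intro below_add) auto
  note car = R_carrier[OF a(2)] R_carrier[OF b(2)] R_carrier[OF c(1)] below_carrier[OF a(4)]
    below_carrier[OF b(4)] below_carrier[OF c(3)] below_carrier[OF g]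
    monomial_closed[OF a(1)] monomial_closed[OF b(1)] monomial_closed[OF s]
  let ?r = "a \<otimes> p \<oplus> a \<otimes> xpow \<alpha> \<otimes> m \<oplus> l \<otimes> g"
  have "?r \<in> below (weight \<alpha> + weight \<beta>)"
    using below_lmult[OF a(2) c(3)] mult_below[OF ax(1) b(4)] mult_below'[OF a(4) g]
    by (intro below_add)
  moreover have "f \<otimes> g = (a \<otimes> c) \<otimes> xpow (\<lambda>k. \<alpha> k + \<beta> k) \<oplus> ?r"
  proof -
    have "f \<otimes> g = a \<otimes> xpow \<alpha> \<otimes> g \<oplus> l \<otimes> g" unfolding a(5) using car by (simp add: l_distr)
    also have "a \<otimes> xpow \<alpha> \<otimes> g = a \<otimes> (xpow \<alpha> \<otimes> (b \<otimes> xpow \<beta>)) \<oplus> a \<otimes> xpow \<alpha> \<otimes> m"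
      unfolding b(5) using car by (simp add: r_distr m_assoc)
    finally show ?thesis unfolding c(4) using car by (simp add: r_distr m_assoc a_assoc)
  qed
  moreover have "a \<otimes> c \<in> R" "a \<otimes> c \<notin> P" using R_mult a c P_prime by blast+
  ultimately show ?thesis using s wt unfolding leading_def by metis
qed

lemma leading_one: "leading \<one> (\<lambda>_. 0)"
  unfolding leading_def
  by (intro conjI exI[of _ \<one>] exI[of _ \<zero>])
    (simp_all add: exponents_def R_one P_one below_zero monomial_zero)

lemma leading_pow: "leading f \<alpha> \<Longrightarrow> \<exists>\<beta>. leading (f [^] (k::nat)) \<beta>"
  by (induction k) (use leading_one leading_mult in \<open>auto, blast\<close>)

lemma leading_nonzero: "\<not> leading \<zero> \<alpha>"
proof
  assume "leading \<zero> \<alpha>"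
  then obtain a l where a: "\<alpha> \<in> exponents n" "a \<in> R" "a \<notin> P" "l \<in> below (weight \<alpha>)"
    "\<zero> = a \<otimes> xpow \<alpha> \<oplus> l" unfolding leading_def by blast
  have "coeff \<zero> \<alpha> = a \<oplus> coeff l \<alpha>"
    by (subst a(5)) (use a below_carrier R_carrier monomial_closed in \<open>simp add: coeff_add coeff_monomial\<close>)
  moreover have "coeff l \<alpha> \<in> P" using a(1,4) by (simp add: below_def)
  ultimately have "a = \<ominus> coeff l \<alpha>"
    using R_carrier[OF a(2)] R_carrier[OF P_R] coeff_zero by (metis add.inv_equality minus_minus a_comm)
  then show False using P_minus \<open>coeff l \<alpha> \<in> P\<close> a(3) by simp
qed

text \<open>Among the exponents with coefficient outside \<open>P\<close>, one of maximal weight is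
  chosen. Injectivity of the weight excludes a second one of the same weight, so the rest of
  \<open>f\<close> lies strictly below.\<close>

lemma leading_exists:
  assumes f: "f \<in> carrier A" and inj: "inj_on weight {\<alpha>. coeff f \<alpha> \<noteq> \<zero>}" and "coeff f \<gamma> \<notin> P"
  shows "\<exists>\<alpha>. leading f \<alpha>"
proof -
  let ?M = "{\<alpha>. coeff f \<alpha> \<notin> P}"
  have sub: "?M \<subseteq> {\<alpha>. coeff f \<alpha> \<noteq> \<zero>}" using P_zero by auto
  then have fin: "finite (weight ` ?M)" using finite_support[OF f] finite_subset by blast
  have "weight ` ?M \<noteq> {}" using assms(3) by blast
  then obtain \<alpha> where \<alpha>: "\<alpha> \<in> ?M" "weight \<alpha> = Max (weight ` ?M)" using Max_in[OF fin] by fastforce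
  have E: "\<alpha> \<in> exponents n" using \<alpha>(1) sub support_exponents[OF f] by blast
  let ?l = "f \<ominus> coeff f \<alpha> \<otimes> xpow \<alpha>"
  note car = f R_carrier[OF coeff_closed[OF f]] monomial_closed[OF E]
  have lcoeff: "coeff ?l \<beta> = coeff f \<beta> \<ominus> (if \<beta> = \<alpha> then coeff f \<alpha> else \<zero>)" for \<beta>
    using car E coeff_closed[OF f] by (simp add: coeff_minus coeff_monomial)
  have "coeff ?l \<beta> \<in> P" if \<beta>: "\<beta> \<in> exponents n" "weight \<alpha> \<le> weight \<beta>" for \<beta>
  proof (cases "\<beta> = \<alpha>")
    case True
    then show ?thesis
      using lcoeff car(2) P_zero by (simp add: a_minus_def r_neg)
  next
    case False
    have "\<beta> \<notin> ?M"
    proof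
      assume M: "\<beta> \<in> ?M"
      then have "weight \<beta> \<le> weight \<alpha>" unfolding \<alpha>(2) using fin by simp
      then show False using inj_onD[OF inj, of \<alpha> \<beta>] \<beta>(2) M \<alpha>(1) sub False by auto
    qed
    then show ?thesis
      using lcoeff False car(2) by (simp add: a_minus_def)
  qed
  then have "?l \<in> below (weight \<alpha>)" using car by (simp add: below_def)
  moreover have "f = coeff f \<alpha> \<otimes> xpow \<alpha> \<oplus> ?l" using car by algebra
  ultimately show ?thesis
    unfolding leading_def using E \<alpha>(1) coeff_closed[OF f] by blast
qed

lemma mult_not_nilpotent:
  assumes "f \<in> carrier A" "g \<in> carrier A"
    and "inj_on weight ({\<alpha>. coeff f \<alpha> \<noteq> \<zero>} \<union> {\<alpha>. coeff g \<alpha> \<noteq> \<zero>})"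
    and "coeff f \<gamma> \<notin> P" "coeff g \<gamma>' \<notin> P"
  shows "f \<otimes> g \<notin> nilpotents A"
proof
  assume "f \<otimes> g \<in> nilpotents A"
  then obtain k :: nat where "(f \<otimes> g) [^] k = \<zero>" by (auto simp: nilpotents_def)
  moreover obtain \<alpha> where "leading f \<alpha>"
    using leading_exists[OF assms(1) inj_on_subset[OF assms(3)] assms(4)] by blast
  moreover obtain \<beta> where "leading g \<beta>"
    using leading_exists[OF assms(2) inj_on_subset[OF assms(3)] assms(5)] by blast
  ultimately show False using leading_pow[OF leading_mult] leading_nonzero by metis
qed

end

section \<open>From compatibility to the Armendariz property\<close>

lemma iterates_single:
  assumes "i \<in> {1..n}"
  shows "iterates n h ((\<lambda>_. 0)(i := Suc 0)) = h i"
proof -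
  have "foldr (\<lambda>j g. (h j ^^ ((\<lambda>_. 0)(i := Suc 0)) j) \<circ> g) is id = (if i \<in> set is then h i else id)"
    if "distinct is" for "is"
    using that by (induction "is") auto
  from this[of "[1..<Suc n]"] show ?thesis using assms unfolding iterates_def by auto
qed

theorem theorem3p10:
  fixes A :: "('a, 'm) ring_scheme" and R :: "'a set" and n :: nat and x :: "nat \<Rightarrow> 'a"
    and \<sigma> \<delta> :: "nat \<Rightarrow> 'a \<Rightarrow> 'a"
  assumes "skew_PBW_extension A R n x"
    and "associated_families A R n x \<sigma> \<delta>"
    and "Sigma_Delta_compatible (A\<lparr>carrier := R\<rparr>) n \<sigma> \<delta>"
    and "reversible (A\<lparr>carrier := R\<rparr>)"
  shows "skew_Pi_Armendariz A R n x"
proof -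
  interpret skew_PBW_extension A R n x by (rule assms(1))
  let ?B = "A\<lparr>carrier := R\<rparr>"
  interpret B: reversible_ring ?B
    using subring_is_ring[OF subring] assms(4)
    by (simp add: reversible_ring_def reversible_ring_axioms_def)
  have \<sigma>R: "\<sigma> i r \<in> R" and \<delta>R: "\<delta> i r \<in> R" if "i \<in> {1..n}" "r \<in> R" for i r
    using assms(2) that by (auto simp: associated_families_def ring_hom_def skew_derivation_def)
  have unit: "(\<lambda>_. 0)(i := Suc 0) \<in> exponents n" if "i \<in> {1..n}" for i
    using that by (simp add: exponents_def)
  have ann_\<sigma>: "y \<otimes>\<^bsub>A\<^esub> \<sigma> i r = \<zero>\<^bsub>A\<^esub> \<longleftrightarrow> y \<otimes>\<^bsub>A\<^esub> r = \<zero>\<^bsub>A\<^esub>" if "i \<in> {1..n}" "y \<in> R" "r \<in> R" for i y r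
    using assms(3) unit[OF that(1)] that iterates_single[OF that(1), of \<sigma>]
    unfolding Sigma_Delta_compatible_def Sigma_compatible_def by fastforce
  have ann_\<delta>: "y \<otimes>\<^bsub>A\<^esub> \<delta> i r = \<zero>\<^bsub>A\<^esub>" if "i \<in> {1..n}" "y \<in> R" "r \<in> R" "y \<otimes>\<^bsub>A\<^esub> r = \<zero>\<^bsub>A\<^esub>" for i y r
    using assms(3) unit[OF that(1)] that iterates_single[OF that(1), of \<delta>]
    unfolding Sigma_Delta_compatible_def Delta_compatible_def by fastforce
  have "a i \<otimes>\<^bsub>A\<^esub> b j \<in> nilpotents ?B"
    if f: "is_expansion A R n x f m a X" and g: "is_expansion A R n x g t b Y"
      and fg: "f \<otimes>\<^bsub>A\<^esub> g \<in> nilpotents A" and ij: "i \<in> {0..m}" "j \<in> {0..t}"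
    for f g m t a b X Y i j
  proof (rule ccontr)
    assume nil: "a i \<otimes>\<^bsub>A\<^esub> b j \<notin> nilpotents ?B"
    \<comment> \<open>The entries of an arbitrary expansion are coefficients in the sense of
      \<open>coeff\<close>: distinctness of the monomials \<open>X k\<close> makes the chosen
      exponent vectors distinct.\<close>
    have coeff_eq: "\<exists>\<alpha>. coeff h \<alpha> = e i" and h_closed: "h \<in> carrier A" and e_closed: "e i \<in> R"
      if h: "is_expansion A R n x h m e X" and i: "i \<in> {0..m}" for h m e X and i :: nat
    proof -
      obtain \<alpha> where \<alpha>: "\<And>k. k \<in> {0..m} \<Longrightarrow> \<alpha> k \<in> exponents n \<and> X k = xpow (\<alpha> k)"
      proof -
        have "\<forall>k \<in> {0..m}. \<exists>\<alpha>. \<alpha> \<in> exponents n \<and> X k = xpow \<alpha>"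
          using h unfolding is_expansion_def monomials_def by blast
        then show ?thesis using that by metis
      qed
      have e: "e \<in> {0..m} \<rightarrow> R" using h by (simp add: is_expansion_def)
      have "inj_on \<alpha> {0..m}"
        using h \<alpha> unfolding is_expansion_def inj_on_def by metis
      moreover have "h = (\<Oplus>\<^bsub>A\<^esub>k \<in> {0..m}. e k \<otimes>\<^bsub>A\<^esub> xpow (\<alpha> k))"
        using h \<alpha> e monomial_closed R_carrier unfolding is_expansion_def
        by (auto intro!: finsum_cong' simp: Pi_iff)
      ultimately show "\<exists>\<alpha>. coeff h \<alpha> = e i"
        using coeff_indexed[of "{0..m}" \<alpha> e i] \<alpha> e i by auto
      show "h \<in> carrier A"
        using h \<alpha> e monomial_closed R_carrier unfolding is_expansion_def
        by (auto intro!: finsum_closed simp: Pi_iff)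
      show "e i \<in> R" using e i by blast
    qed
    have prod_R: "a i \<otimes>\<^bsub>A\<^esub> b j \<in> R"
      using e_closed[OF f ij(1)] e_closed[OF g ij(2)] subringE(6)[OF subring] by blast
    show False
    proof (rule B.separating_completely_prime[OF _ nil, simplified, OF prod_R])
      fix P assume P: "P \<subseteq> R" "a i \<otimes>\<^bsub>A\<^esub> b j \<notin> P" "\<zero>\<^bsub>A\<^esub> \<in> P" "\<one>\<^bsub>A\<^esub> \<notin> P"
        "\<And>a b. \<lbrakk>a \<in> P; b \<in> P\<rbrakk> \<Longrightarrow> a \<oplus>\<^bsub>A\<^esub> b \<in> P"
        "\<And>a r. \<lbrakk>a \<in> P; r \<in> R\<rbrakk> \<Longrightarrow> r \<otimes>\<^bsub>A\<^esub> a \<in> P"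
        "\<And>a r. \<lbrakk>a \<in> P; r \<in> R\<rbrakk> \<Longrightarrow> a \<otimes>\<^bsub>A\<^esub> r \<in> P"
        "\<And>a b. \<lbrakk>a \<in> R; b \<in> R; a \<otimes>\<^bsub>A\<^esub> b \<in> P\<rbrakk> \<Longrightarrow> a \<in> P \<or> b \<in> P"
        "\<And>a h. \<lbrakk>a \<in> P; h \<in> R; \<And>y. \<lbrakk>y \<in> R; y \<otimes>\<^bsub>A\<^esub> a = \<zero>\<^bsub>A\<^esub>\<rbrakk> \<Longrightarrow> y \<otimes>\<^bsub>A\<^esub> h = \<zero>\<^bsub>A\<^esub>\<rbrakk> \<Longrightarrow> h \<in> P"
      note fA = h_closed[OF f ij(1)] and gA = h_closed[OF g ij(2)]
      let ?F = "{\<alpha>. coeff f \<alpha> \<noteq> \<zero>\<^bsub>A\<^esub>} \<union> {\<alpha>. coeff g \<alpha> \<noteq> \<zero>\<^bsub>A\<^esub>}"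
      have F: "finite ?F" "?F \<subseteq> exponents n"
        using finite_support support_exponents fA gA by auto
      obtain w :: "nat \<Rightarrow> nat" where w: "\<And>i. w i > 0"
        "\<And>i j k. \<lbrakk>i \<le> n; j \<le> n; k \<le> n\<rbrakk> \<Longrightarrow> w k < w i + w j"
        "inj_on (\<lambda>\<alpha>. \<Sum>i = 1..n. \<alpha> i * w i) ?F"
        using separating_weights[OF F] by blast
      interpret W: weighted_prime A R n x \<sigma> \<delta> P w
      proof
        \<comment> \<open>By compatibility \<open>r\<close> and \<open>\<sigma> i r\<close> have the
          same left annihilator in \<open>R\<close>, hence both directions; the left annihilator of
          \<open>r\<close> also kills \<open>\<delta> i r\<close>.\<close>
        show "\<sigma> i r \<in> P \<longleftrightarrow> r \<in> P" if "i \<in> {1..n}" "r \<in> R" for i r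
          using P(9)[of r "\<sigma> i r"] P(9)[of "\<sigma> i r" r] ann_\<sigma> \<sigma>R that by blast
        show "\<delta> i r \<in> P" if "i \<in> {1..n}" "r \<in> P" for i r
          using P(9)[of r "\<delta> i r"] ann_\<delta> \<delta>R that P(1) by blast
      qed (use assms(2) P(1,3-8) w(1,2) in auto)
      have "W.weight = (\<lambda>\<alpha>. \<Sum>i = 1..n. \<alpha> i * w i)" by (simp add: W.weight_def fun_eq_iff)
      then have inj: "inj_on W.weight ?F" using w(3) by simp
      obtain \<gamma> \<gamma>' where "coeff f \<gamma> = a i" "coeff g \<gamma>' = b j"
        using coeff_eq[OF f ij(1)] coeff_eq[OF g ij(2)] by blast
      \<comment> \<open>As \<open>P\<close> is a two-sided ideal that misses the product, it misses
        both factors, so \<open>f\<close> and \<open>g\<close> each have a coefficient outside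
        \<open>P\<close>.\<close>
      moreover have "a i \<notin> P" "b j \<notin> P"
        using P(2,6,7) e_closed[OF f ij(1)] e_closed[OF g ij(2)] by blast+
      ultimately show False using W.mult_not_nilpotent[OF fA gA inj] fg by metis
    qed
  qed
  then show ?thesis unfolding skew_Pi_Armendariz_def by blast
qed

end
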